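(* Let $L>0$, $a>0$, $r>0$, $T>0$, and consider on the real Hilbert space $H=\ell^2\times\ell^2$ the bilinear control system $$\dot x(t)=(A+u(t)B)x(t),\qquad A=\begin{pmatrix}0&\Omega\\-\Omega&0\end{pmatrix},\qquad B=\begin{pmatrix}0&0\\ b&0\end{pmatrix},$$ where $\Omega=\mathrm{diag}(\omega_1,\omega_2,\dots)$ with $\omega_n=a(\pi n/L)^2$, and $b=(b_{nj})_{n,j\ge1}$ is the infinite matrix with entries $$b_{nj}=-\frac1{\omega_j}\int_{z_1}^{z_2}\varphi_j'(z)\varphi_n'(z)\,dz,\qquad \varphi_n(z)=\sqrt{\tfrac2L}\,\sin\left(\tfrac{\pi n z}{L}\right),$$ in the case $[z_1,z_2]=[0,L]$ (so that $B=-\frac1a\begin{pmatrix}0&0\\ I&0\end{pmatrix}$, with $I$ the identity operator on $\ell^2$). Let $K$ be a nonempty subset of $L^2(0,T)$ such that $\|u(\cdot)\|_{L^2(0,T)}\le r$ for all $u(\cdot)\in K$. Then, for any initial state $x_0\in H$ and $T<(a/r)^2$, the reachable set $\mathcal R_T(x_0)=\{x(T)\mid x(0)=x_0,\ u(\cdot)\in K\}\subset H$ of this system with controls from $K$ satisfies, for each $n\in\mathbb N$, $n\ge1$, $$d_n(\mathcal R_T(x_0))_H\le\frac{\|x_0\|\sqrt T}{a}\,d_n(K)_{L^2(0,T)}+\frac{\|x_0\|\,T\,r^2}{a(a-\sqrt T\,r)} .$$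
   Context: This system is the modal (Galerkin) form of a simply supported Euler--Bernoulli beam of length $L$ controlled by a contraction force. The state is $x=(\xi,\eta)$ with $\xi,\eta\in\ell^2$, the inner product is $\langle x,\tilde x\rangle_H=\sum_{n\ge1}(\xi_n\tilde\xi_n+\eta_n\tilde\eta_n)$, operators act by matrix-vector multiplication, and $D(A)=\{(\xi,\eta)\in H\mid \sum_{n\ge1}\omega_n^2(\xi_n^2+\eta_n^2)<\infty\}$. The operator $A$ generates a $C_0$-group on $H$ acting on each pair $(\xi_n,\eta_n)$ by $e^{tA_n}=\begin{pmatrix}\cos\omega_nt&\sin\omega_nt\\-\sin\omega_nt&\cos\omega_nt\end{pmatrix}$. Here $L^2(0,T)$ is the real Lebesgue space. For $u\in L^2(0,T)$ the solution with $x(0)=x_0$ is the (mild) solution, represented by the Volterra series $$x(t)=e^{tA}x_0+\sum_{k=1}^\infty\int_0^t\int_0^{\sigma_k}\cdots\int_0^{\sigma_2}e^{(t-\sigma_k)A}Be^{(\sigma_k-\sigma_{k-1})A}B\cdots Be^{\sigma_1A}x_0\;u(\sigma_1)\cdots u(\sigma_k)\,d\sigma_1\cdots d\sigma_k$$ (the $k=1$ term being $\int_0^te^{(t-\sigma_1)A}Be^{\sigma_1A}x_0u(\sigma_1)\,d\sigma_1$). For a Banach space $Z$, $\mathrm{Aff}_n(Z)$ denotes the set of all affine subspaces of $Z$ of dimension at most $n$, i.e. sets $W=c+W_0$ with $c\in Z$ and $W_0$ a linear subspace of dimension at most $n$. For a nonempty set $S\subset Z$ and $n\ge1$, the affine Kolmogorov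 $n$-width is $$d_n(S)_Z=\inf_{W\in \mathrm{Aff}_n(Z)}\ \sup_{x\in S}\ \inf_{\xi\in W}\|x-\xi\|_Z .$$ *)

theory Defs
  imports "HOL-Analysis.Analysis"
begin

section \<open>The real Hilbert space of square-summable sequences\<close>

text \<open>Coordinate \<open>i\<close> of an element of \<open>ell2\<close> is the mathematical component with index \<open>i + 1\<close>.\<close>

typedef ell2 = "{f :: nat \<Rightarrow> real. summable (\<lambda>i. (f i)\<^sup>2)}"
  morphisms ell2_nth Abs_ell2
  by (rule exI[of _ "\<lambda>_. 0"]) simp

setup_lifting type_definition_ell2

lemma ell2_summable [simp]: "summable (\<lambda>i. (ell2_nth x i)\<^sup>2)"
  using ell2_nth[of x] by simp

lemma ell2_eqI: "(\<And>i. ell2_nth x i = ell2_nth y i) \<Longrightarrow> x = y"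
  by (metis ell2_nth_inject ext)

lemma ell2_nth_Abs: "summable (\<lambda>i. (f i)\<^sup>2) \<Longrightarrow> ell2_nth (Abs_ell2 f) = f"
  by (simp add: Abs_ell2_inverse)

lemma summable_sq_prod:
  fixes f g :: "nat \<Rightarrow> real"
  assumes "summable (\<lambda>i. (f i)\<^sup>2)" "summable (\<lambda>i. (g i)\<^sup>2)"
  shows "summable (\<lambda>i. f i * g i)"
proof (rule summable_comparison_test')
  show "summable (\<lambda>i. (f i)\<^sup>2 + (g i)\<^sup>2)" using assms by (rule summable_add)
  fix i
  have "0 \<le> (\<bar>f i\<bar> - \<bar>g i\<bar>)\<^sup>2" by simp
  then have "2 * (\<bar>f i\<bar> * \<bar>g i\<bar>) \<le> (f i)\<^sup>2 + (g i)\<^sup>2" by (simp add: power2_diff)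
  moreover have "0 \<le> \<bar>f i\<bar> * \<bar>g i\<bar>" by simp
  ultimately show "norm (f i * g i) \<le> (f i)\<^sup>2 + (g i)\<^sup>2" unfolding real_norm_def abs_mult by linarith
qed

lemma summable_sq_add:
  fixes f g :: "nat \<Rightarrow> real"
  assumes "summable (\<lambda>i. (f i)\<^sup>2)" "summable (\<lambda>i. (g i)\<^sup>2)"
  shows "summable (\<lambda>i. (f i + g i)\<^sup>2)"
proof -
  have "summable (\<lambda>i. ((f i)\<^sup>2 + (g i)\<^sup>2) + 2 * (f i * g i))"
    by (intro summable_add summable_mult summable_sq_prod assms)
  then show ?thesis by (simp add: power2_sum algebra_simps)
qed

lemma summable_sq_cmult:
  fixes f :: "nat \<Rightarrow> real"
  assumes "summable (\<lambda>i. (f i)\<^sup>2)"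
  shows "summable (\<lambda>i. (c * f i)\<^sup>2)"
  using summable_mult[OF assms, of "c\<^sup>2"] by (simp add: power_mult_distrib)

lemma summable_sq_bound:
  fixes f g :: "nat \<Rightarrow> real"
  assumes "summable (\<lambda>i. (f i)\<^sup>2)" "\<And>i. \<bar>g i\<bar> \<le> \<bar>f i\<bar>"
  shows "summable (\<lambda>i. (g i)\<^sup>2)"
  by (rule summable_comparison_test'[OF assms(1), of 0]) (use assms(2) in \<open>simp add: abs_le_square_iff\<close>)

instantiation ell2 :: real_vector
begin

lift_definition zero_ell2 :: ell2 is "\<lambda>_. 0" by simp
lift_definition plus_ell2 :: "ell2 \<Rightarrow> ell2 \<Rightarrow> ell2" is "\<lambda>f g i. f i + g i"
  by (rule summable_sq_add)
lift_definition uminus_ell2 :: "ell2 \<Rightarrow> ell2" is "\<lambda>f i. - f i" by simp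
lift_definition minus_ell2 :: "ell2 \<Rightarrow> ell2 \<Rightarrow> ell2" is "\<lambda>f g i. f i - g i"
  subgoal for f g using summable_sq_add[of f "\<lambda>i. - g i"] by simp
  done
lift_definition scaleR_ell2 :: "real \<Rightarrow> ell2 \<Rightarrow> ell2" is "\<lambda>c f i. c * f i"
  by (rule summable_sq_cmult)

instance
  by standard (transfer; simp add: fun_eq_iff algebra_simps)+

end

instantiation ell2 :: real_inner
begin

definition inner_ell2 :: "ell2 \<Rightarrow> ell2 \<Rightarrow> real"
  where "inner_ell2 x y = (\<Sum>i. ell2_nth x i * ell2_nth y i)"
definition norm_ell2 :: "ell2 \<Rightarrow> real" where "norm_ell2 x = sqrt (inner x x)"
definition sgn_ell2 :: "ell2 \<Rightarrow> ell2" where "sgn_ell2 x = x /\<^sub>R norm x"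
definition dist_ell2 :: "ell2 \<Rightarrow> ell2 \<Rightarrow> real" where "dist_ell2 x y = norm (x - y)"
definition uniformity_ell2 :: "(ell2 \<times> ell2) filter"
  where "uniformity_ell2 = (INF e\<in>{0 <..}. principal {(x, y). dist x y < e})"
definition open_ell2 :: "ell2 set \<Rightarrow> bool"
  where "open_ell2 U = (\<forall>x\<in>U. \<forall>\<^sub>F (x', y) in uniformity. x' = x \<longrightarrow> y \<in> U)"

instance
proof
  fix x y z :: ell2 and r :: real
  have s: "summable (\<lambda>i. ell2_nth x i * ell2_nth y i)" for x y
    by (simp add: summable_sq_prod)
  show "inner x y = inner y x" by (simp add: inner_ell2_def mult.commute)
  show "inner (x + y) z = inner x z + inner y z"
    by (simp add: inner_ell2_def plus_ell2.rep_eq suminf_add[OF s s] algebra_simps)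
  show "inner (r *\<^sub>R x) y = r * inner x y"
    by (simp add: inner_ell2_def scaleR_ell2.rep_eq suminf_mult[OF s] mult.assoc)
  show "0 \<le> inner x x"
    unfolding inner_ell2_def by (rule suminf_nonneg[OF s]) simp
  show "(inner x x = 0) = (x = 0)"
    unfolding inner_ell2_def using suminf_eq_zero_iff[OF s[of x x]]
    by (auto simp: zero_ell2.rep_eq intro!: ell2_eqI)
  show "norm x = sqrt (inner x x)" by (rule norm_ell2_def)
qed (rule sgn_ell2_def dist_ell2_def uniformity_ell2_def open_ell2_def)+

end

lemma norm_ell2_sq: "(norm (x::ell2))\<^sup>2 = (\<Sum>i. (ell2_nth x i)\<^sup>2)"
  unfolding power2_norm_eq_inner by (simp add: inner_ell2_def power2_eq_square)

lemma ell2_nth_le_norm: "\<bar>ell2_nth x i\<bar> \<le> norm x"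
proof -
  have "(\<Sum>i\<in>{i}. (ell2_nth x i)\<^sup>2) \<le> (\<Sum>i. (ell2_nth x i)\<^sup>2)"
    by (rule sum_le_suminf) auto
  then have "(ell2_nth x i)\<^sup>2 \<le> (norm x)\<^sup>2" by (simp add: norm_ell2_sq)
  then show ?thesis by (simp add: abs_le_square_iff[symmetric])
qed

lemma bounded_linear_ell2_nth: "bounded_linear (\<lambda>x. ell2_nth x i)"
  by (rule bounded_linear_intro[where K=1])
    (auto simp: plus_ell2.rep_eq scaleR_ell2.rep_eq ell2_nth_le_norm)

instance ell2 :: banach
proof
  fix X :: "nat \<Rightarrow> ell2"
  assume X: "Cauchy X"
  have "Cauchy (\<lambda>n. ell2_nth (X n) i)" for i
    using bounded_linear.Cauchy[OF bounded_linear_ell2_nth X] .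
  then have "\<exists>l. (\<lambda>n. ell2_nth (X n) i) \<longlonglongrightarrow> l" for i
    by (simp add: Cauchy_convergent convergent_def[symmetric])
  then obtain l where l: "\<And>i. (\<lambda>n. ell2_nth (X n) i) \<longlonglongrightarrow> l i" by metis
  have key: "\<exists>N. \<forall>m\<ge>N. \<forall>k. (\<Sum>i<k. (ell2_nth (X m) i - l i)\<^sup>2) \<le> e\<^sup>2" if e: "e > 0" for e
  proof -
    obtain N where N: "\<And>m n. m \<ge> N \<Longrightarrow> n \<ge> N \<Longrightarrow> norm (X m - X n) < e"
      using X e unfolding Cauchy_def dist_norm by blast
    have "(\<Sum>i<k. (ell2_nth (X m) i - l i)\<^sup>2) \<le> e\<^sup>2" if m: "m \<ge> N" for m k
    proof (rule tendsto_le[OF sequentially_bot tendsto_const])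
      show "(\<lambda>n. \<Sum>i<k. (ell2_nth (X m) i - ell2_nth (X n) i)\<^sup>2) \<longlonglongrightarrow> (\<Sum>i<k. (ell2_nth (X m) i - l i)\<^sup>2)"
        by (intro tendsto_intros l)
      show "\<forall>\<^sub>F n in sequentially. (\<Sum>i<k. (ell2_nth (X m) i - ell2_nth (X n) i)\<^sup>2) \<le> e\<^sup>2"
      proof (rule eventually_sequentiallyI[of N])
        fix n assume n: "n \<ge> N"
        have "(\<Sum>i<k. (ell2_nth (X m) i - ell2_nth (X n) i)\<^sup>2) \<le> (\<Sum>i. (ell2_nth (X m - X n) i)\<^sup>2)"
          using sum_le_suminf[OF ell2_summable[of "X m - X n"], of "{..<k}"]
          by (simp add: minus_ell2.rep_eq)
        also have "\<dots> = (norm (X m - X n))\<^sup>2" by (simp add: norm_ell2_sq)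
        also have "\<dots> \<le> e\<^sup>2" using N[OF m n] by (intro power_mono) auto
        finally show "(\<Sum>i<k. (ell2_nth (X m) i - ell2_nth (X n) i)\<^sup>2) \<le> e\<^sup>2" .
      qed
    qed
    then show ?thesis by blast
  qed
  have sm: "summable (\<lambda>i. (ell2_nth (X m) i - l i)\<^sup>2)"
    if "\<forall>k. (\<Sum>i<k. (ell2_nth (X m) i - l i)\<^sup>2) \<le> e\<^sup>2" for m e
    by (rule summableI_nonneg_bounded) (use that in auto)
  obtain N1 where N1: "\<forall>m\<ge>N1. \<forall>k. (\<Sum>i<k. (ell2_nth (X m) i - l i)\<^sup>2) \<le> 1\<^sup>2"
    using key[of 1] by auto
  have "summable (\<lambda>i. (ell2_nth (X N1) i - l i)\<^sup>2)" using sm N1 by blast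
  then have "summable (\<lambda>i. (ell2_nth (X N1) i + - 1 * (ell2_nth (X N1) i - l i))\<^sup>2)"
    by (intro summable_sq_add summable_sq_cmult) auto
  then have ls: "summable (\<lambda>i. (l i)\<^sup>2)" by simp
  have "X \<longlonglongrightarrow> Abs_ell2 l"
  proof (rule LIMSEQ_I)
    fix r :: real assume r: "r > 0"
    obtain N where N: "\<forall>m\<ge>N. \<forall>k. (\<Sum>i<k. (ell2_nth (X m) i - l i)\<^sup>2) \<le> (r/2)\<^sup>2"
      using key[of "r/2"] r by auto
    have "norm (X m - Abs_ell2 l) < r" if "m \<ge> N" for m
    proof -
      have "(norm (X m - Abs_ell2 l))\<^sup>2 = (\<Sum>i. (ell2_nth (X m) i - l i)\<^sup>2)"
        by (simp add: norm_ell2_sq minus_ell2.rep_eq ell2_nth_Abs[OF ls])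
      also have "\<dots> \<le> (r/2)\<^sup>2"
        using N that by (intro suminf_le_const sm[where e="r/2"]) auto
      finally have "norm (X m - Abs_ell2 l) \<le> r/2" by (rule power2_le_imp_le) (use r in simp)
      then show ?thesis using r by simp
    qed
    then show "\<exists>no. \<forall>n\<ge>no. norm (X n - Abs_ell2 l) < r" by blast
  qed
  then show "convergent X" by (auto simp: convergent_def)
qed

lemma ell2_approx:
  fixes x :: ell2
  assumes "e > 0"
  shows "\<exists>q :: rat list. norm (x - Abs_ell2 (\<lambda>i. if i < length q then of_rat (q ! i) else 0)) < e"
proof -
  have tail: "(\<lambda>k. \<Sum>i. (ell2_nth x (i + k))\<^sup>2) \<longlonglongrightarrow> 0"
    using suminf_exist_split2[OF ell2_summable[of x]] .
  obtain k where k: "(\<Sum>i. (ell2_nth x (i + k))\<^sup>2) < e\<^sup>2 / 2"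
    using eventually_happens[OF order_tendstoD(2)[OF tail, of "e\<^sup>2/2"]] assms by auto
  define d where "d = sqrt (e\<^sup>2 / (2 * real (Suc k)))"
  have d0: "d > 0" and d2: "d\<^sup>2 = e\<^sup>2 / (2 * real (Suc k))" using assms by (auto simp: d_def)
  have "\<exists>q::rat. \<bar>ell2_nth x i - of_rat q\<bar> < d" for i
  proof -
    obtain q where "ell2_nth x i < of_rat q" "of_rat q < ell2_nth x i + d"
      using of_rat_dense[of "ell2_nth x i" "ell2_nth x i + d"] d0 by auto
    then show ?thesis by (intro exI[of _ q]) auto
  qed
  then obtain q :: "nat \<Rightarrow> rat" where q: "\<And>i. \<bar>ell2_nth x i - of_rat (q i)\<bar> < d" by metis
  define qs where "qs = map q [0..<k]"
  have len: "length qs = k" by (simp add: qs_def)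
  define f where "f = (\<lambda>i. if i < length qs then real_of_rat (qs ! i) else 0)"
  have "summable (\<lambda>i. (f i)\<^sup>2)"
    by (rule summable_finite[of "{..<k}"]) (auto simp: f_def len)
  then have nth: "ell2_nth (x - Abs_ell2 f) i = ell2_nth x i - f i" for i
    by (simp add: minus_ell2.rep_eq ell2_nth_Abs)
  have "(norm (x - Abs_ell2 f))\<^sup>2 = (\<Sum>i. (ell2_nth (x - Abs_ell2 f) (i + k))\<^sup>2) + (\<Sum>i<k. (ell2_nth (x - Abs_ell2 f) i)\<^sup>2)"
    unfolding norm_ell2_sq by (rule suminf_split_initial_segment) simp
  also have "(\<Sum>i. (ell2_nth (x - Abs_ell2 f) (i + k))\<^sup>2) < e\<^sup>2 / 2"
    using k unfolding nth by (simp add: f_def len)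
  also have "(\<Sum>i<k. (ell2_nth (x - Abs_ell2 f) i)\<^sup>2) \<le> (\<Sum>i<k. d\<^sup>2)"
  proof (rule sum_mono)
    fix i assume "i \<in> {..<k}"
    then have "\<bar>ell2_nth (x - Abs_ell2 f) i\<bar> \<le> d"
      unfolding nth using q[of i] by (simp add: f_def qs_def)
    then show "(ell2_nth (x - Abs_ell2 f) i)\<^sup>2 \<le> d\<^sup>2"
      by (metis abs_ge_zero power_mono power2_abs)
  qed
  also have "(\<Sum>i<k. d\<^sup>2) \<le> e\<^sup>2 / 2"
    using assms by (simp add: d2 field_simps)
  finally have "(norm (x - Abs_ell2 f))\<^sup>2 < e\<^sup>2" by simp
  then have "norm (x - Abs_ell2 f) < e" by (rule power2_less_imp_less) (use assms in simp)
  then show ?thesis unfolding f_def by blast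
qed

instance ell2 :: second_countable_topology
proof
  define g where "g = (\<lambda>q :: rat list. Abs_ell2 (\<lambda>i. if i < length q then of_rat (q ! i) else 0))"
  define \<B> where "\<B> = (\<lambda>(q, n). ball (g q) (1 / real (Suc n))) ` (UNIV :: (rat list \<times> nat) set)"
  have "countable \<B>" unfolding \<B>_def by (intro countable_image) simp
  moreover have "topological_basis \<B>"
  proof (rule topological_basisI)
    show "open B" if "B \<in> \<B>" for B using that by (auto simp: \<B>_def)
    fix U :: "ell2 set" and x assume "open U" "x \<in> U"
    then obtain e where e: "e > 0" "ball x e \<subseteq> U" by (meson openE)
    obtain n where n: "1 / real (Suc n) < e / 2"
      using nat_approx_posE[of "e/2"] e by auto
    obtain q where q: "norm (x - g q) < 1 / real (Suc n)"
      using ell2_approx[of "1 / real (Suc n)" x] unfolding g_def by auto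
    have "ball (g q) (1 / real (Suc n)) \<subseteq> ball x e"
    proof
      fix y assume "y \<in> ball (g q) (1 / real (Suc n))"
      moreover have "dist x y \<le> dist x (g q) + dist (g q) y" by (rule dist_triangle)
      moreover have "dist x (g q) < 1 / real (Suc n)" using q by (simp add: dist_norm)
      ultimately have "dist x y < e" using n by simp
      then show "y \<in> ball x e" by simp
    qed
    moreover have "x \<in> ball (g q) (1 / real (Suc n))" using q by (simp add: dist_norm norm_minus_commute)
    moreover have "ball (g q) (1 / real (Suc n)) \<in> \<B>" unfolding \<B>_def by (rule image_eqI[of _ _ "(q, n)"]) auto
    ultimately show "\<exists>B'\<in>\<B>. x \<in> B' \<and> B' \<subseteq> U" using e by blast
  qed
  ultimately show "\<exists>B :: ell2 set set. countable B \<and> open = generate_topology B"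
    using topological_basis_imp_subbasis by blast
qed


section \<open>The real Lebesgue space \<open>L\<^sup>2\<close>\<close>

text \<open>
  The type \<open>L2\<close> is \<open>L\<^sup>2(\<real>)\<close>: square-integrable functions modulo equality almost everywhere.
  The space \<open>L\<^sup>2(0, T)\<close> is the subspace of classes vanishing almost everywhere outside \<open>[0, T]\<close>
  (extension by zero).
\<close>

definition L2_rel :: "(real \<Rightarrow> real) \<Rightarrow> (real \<Rightarrow> real) \<Rightarrow> bool" where
  "L2_rel f g \<longleftrightarrow> f \<in> borel_measurable lborel \<and> integrable lborel (\<lambda>s. (f s)\<^sup>2)
     \<and> g \<in> borel_measurable lborel \<and> integrable lborel (\<lambda>s. (g s)\<^sup>2)
     \<and> (AE s in lborel. f s = g s)"

quotient_type L2 = "real \<Rightarrow> real" / partial: L2_rel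
proof (rule part_equivpI)
  show "\<exists>f. L2_rel f f" by (rule exI[of _ "\<lambda>_. 0"]) (simp add: L2_rel_def)
  show "symp L2_rel" by (auto simp: symp_def L2_rel_def elim: AE_mp)
  show "transp L2_rel" by (auto simp: transp_def L2_rel_def)
qed

lemma integrable_sq_prod:
  fixes f g :: "real \<Rightarrow> real"
  assumes "f \<in> borel_measurable lborel" "integrable lborel (\<lambda>s. (f s)\<^sup>2)"
    and "g \<in> borel_measurable lborel" "integrable lborel (\<lambda>s. (g s)\<^sup>2)"
  shows "integrable lborel (\<lambda>s. f s * g s)"
proof (rule Bochner_Integration.integrable_bound)
  show "integrable lborel (\<lambda>s. (f s)\<^sup>2 + (g s)\<^sup>2)" using assms by simp
  show "(\<lambda>s. f s * g s) \<in> borel_measurable lborel" using assms by measurable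
  show "AE s in lborel. norm (f s * g s) \<le> norm ((f s)\<^sup>2 + (g s)\<^sup>2)"
  proof (rule AE_I2)
    fix s
    have "0 \<le> (\<bar>f s\<bar> - \<bar>g s\<bar>)\<^sup>2" by simp
    then have "2 * (\<bar>f s\<bar> * \<bar>g s\<bar>) \<le> (f s)\<^sup>2 + (g s)\<^sup>2" by (simp add: power2_diff)
    moreover have "0 \<le> \<bar>f s\<bar> * \<bar>g s\<bar>" by simp
    ultimately show "norm (f s * g s) \<le> norm ((f s)\<^sup>2 + (g s)\<^sup>2)"
      unfolding real_norm_def abs_mult by linarith
  qed
qed

lemma integrable_sq_add:
  fixes f g :: "real \<Rightarrow> real"
  assumes "f \<in> borel_measurable lborel" "integrable lborel (\<lambda>s. (f s)\<^sup>2)"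
    and "g \<in> borel_measurable lborel" "integrable lborel (\<lambda>s. (g s)\<^sup>2)"
  shows "integrable lborel (\<lambda>s. (f s + g s)\<^sup>2)"
proof -
  have "integrable lborel (\<lambda>s. ((f s)\<^sup>2 + (g s)\<^sup>2) + 2 * (f s * g s))"
    using assms integrable_sq_prod[OF assms] by simp
  then show ?thesis by (simp add: power2_sum algebra_simps)
qed

lemma integrable_sq_diff:
  fixes f g :: "real \<Rightarrow> real"
  assumes "f \<in> borel_measurable lborel" "integrable lborel (\<lambda>s. (f s)\<^sup>2)"
    and "g \<in> borel_measurable lborel" "integrable lborel (\<lambda>s. (g s)\<^sup>2)"
  shows "integrable lborel (\<lambda>s. (f s - g s)\<^sup>2)"
  using integrable_sq_add[of f "\<lambda>s. - g s"] assms by simp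

instantiation L2 :: real_vector
begin

lift_definition zero_L2 :: L2 is "\<lambda>_. 0" by (simp add: L2_rel_def)
lift_definition plus_L2 :: "L2 \<Rightarrow> L2 \<Rightarrow> L2" is "\<lambda>f g s. f s + g s"
  by (auto simp: L2_rel_def intro!: integrable_sq_add elim: AE_mp)
lift_definition uminus_L2 :: "L2 \<Rightarrow> L2" is "\<lambda>f s. - f s"
  by (auto simp: L2_rel_def elim: AE_mp)
lift_definition minus_L2 :: "L2 \<Rightarrow> L2 \<Rightarrow> L2" is "\<lambda>f g s. f s - g s"
  by (auto simp: L2_rel_def intro!: integrable_sq_diff elim: AE_mp)
lift_definition scaleR_L2 :: "real \<Rightarrow> L2 \<Rightarrow> L2" is "\<lambda>c f s. c * f s"
  by (auto simp: L2_rel_def power_mult_distrib elim: AE_mp)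

instance
proof
  fix u v w :: L2 and c d :: real
  show "u + v + w = u + (v + w)" by transfer (auto simp: L2_rel_def add.assoc intro!: integrable_sq_add)
  show "u + v = v + u" by transfer (auto simp: L2_rel_def add.commute intro!: integrable_sq_add)
  show "0 + u = u" by transfer (auto simp: L2_rel_def)
  show "- u + u = 0" by transfer (auto simp: L2_rel_def)
  show "u - v = u + - v"
    by transfer (auto simp: L2_rel_def intro!: integrable_sq_diff)
  show "c *\<^sub>R (u + v) = c *\<^sub>R u + c *\<^sub>R v"
    by transfer (auto simp: L2_rel_def distrib_left power_mult_distrib intro!: integrable_sq_add)
  show "(c + d) *\<^sub>R u = c *\<^sub>R u + d *\<^sub>R u"
    by transfer (auto simp: L2_rel_def distrib_right power_mult_distrib intro!: integrable_sq_add)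
  show "c *\<^sub>R d *\<^sub>R u = (c * d) *\<^sub>R u"
    by transfer (auto simp: L2_rel_def power_mult_distrib mult.assoc)
  show "1 *\<^sub>R u = u" by transfer (auto simp: L2_rel_def)
qed

end

instantiation L2 :: real_inner
begin

lift_definition inner_L2 :: "L2 \<Rightarrow> L2 \<Rightarrow> real" is "\<lambda>f g. LINT s|lborel. f s * g s"
  unfolding L2_rel_def by (intro integral_cong_AE) (auto elim: AE_mp)
definition norm_L2 :: "L2 \<Rightarrow> real" where "norm_L2 u = sqrt (inner u u)"
definition sgn_L2 :: "L2 \<Rightarrow> L2" where "sgn_L2 u = u /\<^sub>R norm u"
definition dist_L2 :: "L2 \<Rightarrow> L2 \<Rightarrow> real" where "dist_L2 u v = norm (u - v)"
definition uniformity_L2 :: "(L2 \<times> L2) filter"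
  where "uniformity_L2 = (INF e\<in>{0 <..}. principal {(u, v). dist u v < e})"
definition open_L2 :: "L2 set \<Rightarrow> bool"
  where "open_L2 U = (\<forall>u\<in>U. \<forall>\<^sub>F (u', v) in uniformity. u' = u \<longrightarrow> v \<in> U)"

instance
proof
  fix u v w :: L2 and c :: real
  show "inner u v = inner v u" by transfer (simp add: mult.commute)
  show "inner (u + v) w = inner u w + inner v w"
    by transfer (auto simp: L2_rel_def distrib_right integrable_sq_prod)
  show "inner (c *\<^sub>R u) v = c * inner u v"
    by transfer (auto simp: L2_rel_def mult.assoc)
  show "0 \<le> inner u u" by transfer (simp add: integral_nonneg_AE)
  show "(inner u u = 0) = (u = 0)"
  proof transfer
    fix f assume f: "L2_rel f f"
    have "(LINT s|lborel. f s * f s) = 0 \<longleftrightarrow> (AE s in lborel. f s * f s = 0)"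
      by (rule integral_nonneg_eq_0_iff_AE) (use f in \<open>auto simp: L2_rel_def power2_eq_square\<close>)
    then show "((LINT s|lborel. f s * f s) = 0) = L2_rel f (\<lambda>_. 0)"
      using f by (auto simp: L2_rel_def)
  qed
  show "norm u = sqrt (inner u u)" by (rule norm_L2_def)
qed (rule sgn_L2_def dist_L2_def uniformity_L2_def open_L2_def)+

end

definition L2_interval :: "real \<Rightarrow> L2 set" where
  "L2_interval T = {u. AE s in lborel. s \<notin> {0..T} \<longrightarrow> rep_L2 u s = 0}"

lemma L2_rel_rep: "L2_rel (rep_L2 u) (rep_L2 u)"
  using Quotient_rep_reflp[OF Quotient_L2] .

lemma L2_rel_rep_abs: "L2_rel f f \<Longrightarrow> L2_rel (rep_L2 (abs_L2 f)) f"
  using Quotient_rep_abs[OF Quotient_L2] .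

lemma L2_interval_norm:
  assumes "u \<in> L2_interval T"
  shows "norm u = sqrt (LINT s:{0..T}|lborel. (rep_L2 u s)\<^sup>2)"
proof -
  have "inner u u = (LINT s|lborel. rep_L2 u s * rep_L2 u s)"
    by (simp add: inner_L2.rep_eq)
  also have "\<dots> = (LINT s:{0..T}|lborel. (rep_L2 u s)\<^sup>2)"
    unfolding set_lebesgue_integral_def
    using L2_rel_rep[of u] assms
    by (intro integral_cong_AE)
      (auto simp: L2_rel_def L2_interval_def power2_eq_square indicator_def elim!: AE_mp)
  finally show ?thesis by (simp add: norm_eq_sqrt_inner)
qed

lemma L2_interval_exhaustive:
  assumes "set_borel_measurable lborel {0..T} f" "set_integrable lborel {0..T} (\<lambda>s. (f s)\<^sup>2)"
  shows "\<exists>u\<in>L2_interval T. AE s in lborel. s \<in> {0..T} \<longrightarrow> rep_L2 u s = f s"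
proof -
  define g where "g = (\<lambda>s. indicat_real {0..T} s * f s)"
  have "(\<lambda>s. (g s)\<^sup>2) = (\<lambda>s. indicat_real {0..T} s * (f s)\<^sup>2)"
    by (auto simp: g_def indicator_def)
  then have "L2_rel g g"
    using assms by (simp add: L2_rel_def set_borel_measurable_def set_integrable_def g_def)
  from L2_rel_rep_abs[OF this] have *: "AE s in lborel. rep_L2 (abs_L2 g) s = g s"
    by (simp add: L2_rel_def)
  show ?thesis
  proof (rule bexI[of _ "abs_L2 g"])
    show "AE s in lborel. s \<in> {0..T} \<longrightarrow> rep_L2 (abs_L2 g) s = f s"
      using * by (rule AE_mp) (auto simp: g_def)
    show "abs_L2 g \<in> L2_interval T"
      unfolding L2_interval_def using * by (auto simp: g_def elim!: AE_mp)
  qed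
qed

lemma subspace_L2_interval: "subspace (L2_interval T)"
proof -
  have rep0: "AE s in lborel. rep_L2 0 s = 0"
    using L2_rel_rep_abs[of "\<lambda>_. 0"] by (simp add: zero_L2_def L2_rel_def)
  have repp: "AE s in lborel. rep_L2 (u + v) s = rep_L2 u s + rep_L2 v s" for u v
  proof -
    have "L2_rel (rep_L2 (abs_L2 (\<lambda>s. rep_L2 u s + rep_L2 v s))) (\<lambda>s. rep_L2 u s + rep_L2 v s)"
      using L2_rel_rep[of u] L2_rel_rep[of v]
      by (intro L2_rel_rep_abs) (auto simp: L2_rel_def intro!: integrable_sq_add)
    then show ?thesis by (simp add: plus_L2_def L2_rel_def)
  qed
  have reps: "AE s in lborel. rep_L2 (c *\<^sub>R u) s = c * rep_L2 u s" for c u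
  proof -
    have "L2_rel (rep_L2 (abs_L2 (\<lambda>s. c * rep_L2 u s))) (\<lambda>s. c * rep_L2 u s)"
      using L2_rel_rep[of u]
      by (intro L2_rel_rep_abs) (auto simp: L2_rel_def power_mult_distrib)
    then show ?thesis by (simp add: scaleR_L2_def L2_rel_def)
  qed
  show ?thesis
    unfolding subspace_def L2_interval_def mem_Collect_eq
  proof (intro conjI allI ballI impI)
    show "AE s in lborel. s \<notin> {0..T} \<longrightarrow> rep_L2 0 s = 0" using rep0 by (rule AE_mp) simp
    fix u v :: L2 and c :: real
    assume u: "u \<in> {u. AE s in lborel. s \<notin> {0..T} \<longrightarrow> rep_L2 u s = 0}"
    then have u': "AE s in lborel. s \<notin> {0..T} \<longrightarrow> rep_L2 u s = 0" by simp
    show "AE s in lborel. s \<notin> {0..T} \<longrightarrow> rep_L2 (c *\<^sub>R u) s = 0"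
      using u' reps[of c u] by eventually_elim simp
    assume v: "v \<in> {u. AE s in lborel. s \<notin> {0..T} \<longrightarrow> rep_L2 u s = 0}"
    then have v': "AE s in lborel. s \<notin> {0..T} \<longrightarrow> rep_L2 v s = 0" by simp
    show "AE s in lborel. s \<notin> {0..T} \<longrightarrow> rep_L2 (u + v) s = 0"
      using u' v' repp[of u v] by eventually_elim simp
  qed
qed

section \<open>Affine Kolmogorov widths\<close>

text \<open>
  The ambient space is a linear subspace \<open>Z\<close> of a normed type.  The dimension bound is expressed
  by a finite spanning set because \<^const>\<open>dim\<close> is \<open>0\<close> on infinite-dimensional subspaces.
  Extended reals make the supremum over an unbounded set infinite.
\<close>

definition affine_subspaces :: "nat \<Rightarrow> 'a::real_normed_vector set \<Rightarrow> 'a set set" where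
  "affine_subspaces n Z = {W. \<exists>c\<in>Z. \<exists>W\<^sub>0. subspace W\<^sub>0 \<and> W\<^sub>0 \<subseteq> Z
     \<and> (\<exists>E. finite E \<and> card E \<le> n \<and> span E = W\<^sub>0) \<and> W = (+) c ` W\<^sub>0}"

definition kolmogorov_width :: "'a::real_normed_vector set \<Rightarrow> nat \<Rightarrow> 'a set \<Rightarrow> ereal" where
  "kolmogorov_width Z n S =
     (INF W\<in>affine_subspaces n Z. SUP x\<in>S. INF y\<in>W. ereal (norm (x - y)))"

section \<open>Bilinear control systems\<close>

text \<open>An unbounded operator is a total function together with its domain \<open>D\<close>.\<close>

definition C0_group :: "(real \<Rightarrow> 'h::real_normed_vector \<Rightarrow> 'h) \<Rightarrow> bool" where
  "C0_group S \<longleftrightarrow> (\<forall>t. bounded_linear (S t)) \<and> S 0 = id \<and> (\<forall>s t. S (s + t) = S s \<circ> S t)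
     \<and> (\<forall>x. ((\<lambda>t. S t x) \<longlongrightarrow> x) (at 0))"

definition generates_group ::
  "'h set \<Rightarrow> ('h \<Rightarrow> 'h) \<Rightarrow> (real \<Rightarrow> 'h \<Rightarrow> 'h::real_normed_vector) \<Rightarrow> bool" where
  "generates_group D A S \<longleftrightarrow> C0_group S
     \<and> (\<forall>x y. ((\<lambda>h. (1 / h) *\<^sub>R (S h x - x)) \<longlongrightarrow> y) (at 0) \<longleftrightarrow> x \<in> D \<and> A x = y)"

text \<open>For the beam, existence and uniqueness of the group are shown in \<open>exp_group_beam\<close> below.\<close>

definition exp_group :: "'h set \<Rightarrow> ('h \<Rightarrow> 'h) \<Rightarrow> real \<Rightarrow> 'h \<Rightarrow> 'h::real_normed_vector" where
  "exp_group D A = (THE S. generates_group D A S)"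

text \<open>
  The equation is the variation-of-constants formula; iterating it gives the Volterra series.
  The value \<open>reachable_set\<close> below does not depend on the representative \<open>rep_L2 u\<close>: changing \<open>u\<close>
  on a null set changes no integral.
\<close>

definition mild_solution ::
  "'h set \<Rightarrow> ('h \<Rightarrow> 'h) \<Rightarrow> ('h \<Rightarrow> 'h) \<Rightarrow> real \<Rightarrow> (real \<Rightarrow> real) \<Rightarrow> 'h
    \<Rightarrow> (real \<Rightarrow> 'h::{banach, second_countable_topology}) \<Rightarrow> bool" where
  "mild_solution D A B T u x\<^sub>0 x \<longleftrightarrow> continuous_on {0..T} x \<and>
     (\<forall>t\<in>{0..T}. set_integrable lborel {0..t} (\<lambda>s. u s *\<^sub>R exp_group D A (t - s) (B (x s))) \<and>
        x t = exp_group D A t x\<^sub>0 + (LINT s:{0..t}|lborel. u s *\<^sub>R exp_group D A (t - s) (B (x s))))"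

definition reachable_set ::
  "'h set \<Rightarrow> ('h \<Rightarrow> 'h) \<Rightarrow> ('h \<Rightarrow> 'h) \<Rightarrow> L2 set \<Rightarrow> real \<Rightarrow> 'h
    \<Rightarrow> 'h::{banach, second_countable_topology} set" where
  "reachable_set D A B K T x\<^sub>0 = {x T | x u. u \<in> K \<and> mild_solution D A B T (rep_L2 u) x\<^sub>0 x}"

section \<open>The beam\<close>

text \<open>
  Matrix entries \<open>M n j\<close> have indices \<open>n, j \<ge> 1\<close>, whence the shift by \<open>Suc\<close>.  The value
  \<open>mat_vec M \<xi>\<close> is meaningful only when the row sums converge to a square-summable sequence.
\<close>

definition mat_vec :: "(nat \<Rightarrow> nat \<Rightarrow> real) \<Rightarrow> ell2 \<Rightarrow> ell2" where
  "mat_vec M \<xi> = Abs_ell2 (\<lambda>i. \<Sum>j. M (Suc i) (Suc j) * ell2_nth \<xi> j)"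

definition beam_freq :: "real \<Rightarrow> real \<Rightarrow> nat \<Rightarrow> real" where
  "beam_freq a L n = a * (pi * real n / L)\<^sup>2"

definition beam_mode :: "real \<Rightarrow> nat \<Rightarrow> real \<Rightarrow> real" where
  "beam_mode L n z = sqrt (2 / L) * sin (pi * real n * z / L)"

definition beam_Omega :: "real \<Rightarrow> real \<Rightarrow> nat \<Rightarrow> nat \<Rightarrow> real" where
  "beam_Omega a L n j = (if n = j then beam_freq a L n else 0)"

definition beam_b :: "real \<Rightarrow> real \<Rightarrow> real \<Rightarrow> real \<Rightarrow> nat \<Rightarrow> nat \<Rightarrow> real" where
  "beam_b a L z\<^sub>1 z\<^sub>2 n j = - (1 / beam_freq a L j) *
     integral {z\<^sub>1..z\<^sub>2} (\<lambda>z. deriv (beam_mode L j) z * deriv (beam_mode L n) z)"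

definition beam_domain :: "real \<Rightarrow> real \<Rightarrow> (ell2 \<times> ell2) set" where
  "beam_domain a L = {(\<xi>, \<eta>). summable (\<lambda>i. (beam_freq a L (Suc i))\<^sup>2 *
     ((ell2_nth \<xi> i)\<^sup>2 + (ell2_nth \<eta> i)\<^sup>2))}"

definition beam_A :: "real \<Rightarrow> real \<Rightarrow> ell2 \<times> ell2 \<Rightarrow> ell2 \<times> ell2" where
  "beam_A a L = (\<lambda>(\<xi>, \<eta>). (mat_vec (beam_Omega a L) \<eta>, - mat_vec (beam_Omega a L) \<xi>))"

definition beam_B :: "real \<Rightarrow> real \<Rightarrow> real \<Rightarrow> real \<Rightarrow> ell2 \<times> ell2 \<Rightarrow> ell2 \<times> ell2" where
  "beam_B a L z\<^sub>1 z\<^sub>2 = (\<lambda>(\<xi>, \<eta>). (0, mat_vec (beam_b a L z\<^sub>1 z\<^sub>2) \<xi>))"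

definition beam_group :: "real \<Rightarrow> real \<Rightarrow> real \<Rightarrow> ell2 \<times> ell2 \<Rightarrow> ell2 \<times> ell2" where
  "beam_group a L t = (\<lambda>(\<xi>, \<eta>).
     (Abs_ell2 (\<lambda>i. cos (beam_freq a L (Suc i) * t) * ell2_nth \<xi> i
                  + sin (beam_freq a L (Suc i) * t) * ell2_nth \<eta> i),
      Abs_ell2 (\<lambda>i. - sin (beam_freq a L (Suc i) * t) * ell2_nth \<xi> i
                  + cos (beam_freq a L (Suc i) * t) * ell2_nth \<eta> i)))"

lemma mat_vec_Omega_nth:
  assumes "summable (\<lambda>i. (beam_freq a L (Suc i) * ell2_nth \<xi> i)\<^sup>2)"
  shows "ell2_nth (mat_vec (beam_Omega a L) \<xi>) i = beam_freq a L (Suc i) * ell2_nth \<xi> i"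
proof -
  have "(\<Sum>j. beam_Omega a L (Suc i) (Suc j) * ell2_nth \<xi> j) = beam_freq a L (Suc i) * ell2_nth \<xi> i" for i
    by (subst suminf_finite[of "{i}"]) (auto simp: beam_Omega_def)
  then show ?thesis using assms by (simp add: mat_vec_def ell2_nth_Abs)
qed

lemma beam_domain_summable:
  assumes "(\<xi>, \<eta>) \<in> beam_domain a L"
  shows "summable (\<lambda>i. (beam_freq a L (Suc i) * ell2_nth \<xi> i)\<^sup>2)"
    and "summable (\<lambda>i. (beam_freq a L (Suc i) * ell2_nth \<eta> i)\<^sup>2)"
proof -
  have s: "summable (\<lambda>i. (beam_freq a L (Suc i))\<^sup>2 * ((ell2_nth \<xi> i)\<^sup>2 + (ell2_nth \<eta> i)\<^sup>2))"
    using assms by (simp add: beam_domain_def)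
  show "summable (\<lambda>i. (beam_freq a L (Suc i) * ell2_nth \<xi> i)\<^sup>2)"
    by (rule summable_comparison_test'[OF s, of 0]) (simp add: power_mult_distrib algebra_simps)
  show "summable (\<lambda>i. (beam_freq a L (Suc i) * ell2_nth \<eta> i)\<^sup>2)"
    by (rule summable_comparison_test'[OF s, of 0]) (simp add: power_mult_distrib algebra_simps)
qed

lemma beam_A_nth:
  assumes "x \<in> beam_domain a L"
  shows "ell2_nth (fst (beam_A a L x)) i = beam_freq a L (Suc i) * ell2_nth (snd x) i"
    and "ell2_nth (snd (beam_A a L x)) i = - beam_freq a L (Suc i) * ell2_nth (fst x) i"
  using beam_domain_summable[of "fst x" "snd x" a L] assms
  by (simp_all add: beam_A_def case_prod_beta uminus_ell2.rep_eq mat_vec_Omega_nth)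

lemma beam_group_nth:
  "ell2_nth (fst (beam_group a L t x)) i =
     cos (beam_freq a L (Suc i) * t) * ell2_nth (fst x) i + sin (beam_freq a L (Suc i) * t) * ell2_nth (snd x) i"
  "ell2_nth (snd (beam_group a L t x)) i =
     - sin (beam_freq a L (Suc i) * t) * ell2_nth (fst x) i + cos (beam_freq a L (Suc i) * t) * ell2_nth (snd x) i"
proof -
  have m: "\<bar>sin u * v\<bar> \<le> \<bar>v\<bar>" "\<bar>cos u * v\<bar> \<le> \<bar>v\<bar>" "\<bar>- sin u * v\<bar> \<le> \<bar>v\<bar>" for u v :: real
    by (simp_all add: abs_mult mult_left_le_one_le)
  have s: "summable (\<lambda>i. (sin (w i) * ell2_nth \<xi> i)\<^sup>2)" "summable (\<lambda>i. (cos (w i) * ell2_nth \<xi> i)\<^sup>2)"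
    "summable (\<lambda>i. (- sin (w i) * ell2_nth \<xi> i)\<^sup>2)" for w \<xi>
    by (rule summable_sq_bound[OF ell2_summable[of \<xi>]], rule m)+
  note s' = summable_sq_add[OF s(2,1)] summable_sq_add[OF s(3,2)]
  show "ell2_nth (fst (beam_group a L t x)) i =
     cos (beam_freq a L (Suc i) * t) * ell2_nth (fst x) i + sin (beam_freq a L (Suc i) * t) * ell2_nth (snd x) i"
    by (simp add: beam_group_def case_prod_beta ell2_nth_Abs[OF s'(1)])
  show "ell2_nth (snd (beam_group a L t x)) i =
     - sin (beam_freq a L (Suc i) * t) * ell2_nth (fst x) i + cos (beam_freq a L (Suc i) * t) * ell2_nth (snd x) i"
    unfolding beam_group_def case_prod_beta snd_conv ell2_nth_Abs[OF s'(2)] ..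
qed

lemma state_eqI:
  fixes x y :: "ell2 \<times> ell2"
  assumes "\<And>i. ell2_nth (fst x) i = ell2_nth (fst y) i" "\<And>i. ell2_nth (snd x) i = ell2_nth (snd y) i"
  shows "x = y"
  using assms by (auto intro!: prod_eqI ell2_eqI)

lemma norm_state_sq:
  fixes x :: "ell2 \<times> ell2"
  shows "(norm x)\<^sup>2 = (\<Sum>i. (ell2_nth (fst x) i)\<^sup>2 + (ell2_nth (snd x) i)\<^sup>2)"
proof -
  have "(norm x)\<^sup>2 = (norm (fst x))\<^sup>2 + (norm (snd x))\<^sup>2" by (simp add: norm_prod_def)
  then show ?thesis by (simp add: norm_ell2_sq suminf_add)
qed

lemma inner_state:
  fixes x y :: "ell2 \<times> ell2"
  shows "inner x y = (\<Sum>i. ell2_nth (fst x) i * ell2_nth (fst y) i + ell2_nth (snd x) i * ell2_nth (snd y) i)"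
  unfolding inner_prod_def inner_ell2_def by (rule suminf_add) (simp_all add: summable_sq_prod)

lemma beam_group_norm: "norm (beam_group a L t x) = norm x"
proof -
  have e: "(cos u * v + sin u * w)\<^sup>2 + (- sin u * v + cos u * w)\<^sup>2 = v\<^sup>2 + w\<^sup>2" for u v w :: real
  proof -
    have "(cos u * v + sin u * w)\<^sup>2 + (- sin u * v + cos u * w)\<^sup>2
        = ((cos u)\<^sup>2 + (sin u)\<^sup>2) * (v\<^sup>2 + w\<^sup>2)" by algebra
    then show ?thesis by simp
  qed
  have "(norm (beam_group a L t x))\<^sup>2 = (norm x)\<^sup>2"
    unfolding norm_state_sq beam_group_nth e ..
  then show ?thesis by simp
qed

lemma state_tendstoI:
  fixes f :: "real \<Rightarrow> ell2 \<times> ell2"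
  assumes F: "F \<noteq> bot"
    and 1: "\<And>i. ((\<lambda>h. ell2_nth (fst (f h)) i) \<longlongrightarrow> ell2_nth (fst l) i) F"
    and 2: "\<And>i. ((\<lambda>h. ell2_nth (snd (f h)) i) \<longlongrightarrow> ell2_nth (snd l) i) F"
    and b: "\<forall>\<^sub>F h in F. \<forall>i. (ell2_nth (fst (f h)) i - ell2_nth (fst l) i)\<^sup>2
               + (ell2_nth (snd (f h)) i - ell2_nth (snd l) i)\<^sup>2 \<le> M i"
    and M: "summable M"
  shows "(f \<longlongrightarrow> l) F"
proof -
  let ?a = "\<lambda>i h. (ell2_nth (fst (f h)) i - ell2_nth (fst l) i)\<^sup>2
               + (ell2_nth (snd (f h)) i - ell2_nth (snd l) i)\<^sup>2"
  have "((\<lambda>h. \<Sum>i. ?a i h) \<longlongrightarrow> (\<Sum>i::nat. 0)) F"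
  proof (rule conjunct2[OF conjunct2[OF tannerys_theorem[OF _ _ M F]]])
    fix i
    have "(?a i \<longlongrightarrow> (ell2_nth (fst l) i - ell2_nth (fst l) i)\<^sup>2 + (ell2_nth (snd l) i - ell2_nth (snd l) i)\<^sup>2) F"
      by (intro tendsto_intros 1 2)
    then show "(?a i \<longlongrightarrow> 0) F" by simp
    have "\<forall>\<^sub>F p in at_top \<times>\<^sub>F F. \<forall>i. ?a i (snd p) \<le> M i"
      using eventually_prodI[OF always_eventually[of "\<lambda>_. True"] b] by simp
    then show "\<forall>\<^sub>F (k, h) in at_top \<times>\<^sub>F F. norm (?a k h) \<le> M k"
      by eventually_elim auto
  qed
  then have "((\<lambda>h. sqrt ((norm (f h - l))\<^sup>2)) \<longlongrightarrow> sqrt 0) F"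
    unfolding norm_state_sq fst_diff snd_diff minus_ell2.rep_eq by (intro tendsto_real_sqrt) simp
  then have "((\<lambda>h. norm (f h - l)) \<longlongrightarrow> 0) F" by simp
  then show ?thesis using Lim_null tendsto_norm_zero_iff by blast
qed

lemma state_sq_summable:
  fixes x :: "ell2 \<times> ell2"
  shows "summable (\<lambda>i. (ell2_nth (fst x) i)\<^sup>2 + (ell2_nth (snd x) i)\<^sup>2)"
  by (intro summable_add) simp_all

lemma beam_group_C0: "C0_group (beam_group a L)"
  unfolding C0_group_def
proof (intro conjI allI)
  show "bounded_linear (beam_group a L t)" for t
    by (rule bounded_linear_intro[where K=1])
      (auto simp: beam_group_norm beam_group_nth plus_ell2.rep_eq scaleR_ell2.rep_eq algebra_simps
        intro!: state_eqI)
  show "beam_group a L 0 = id"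
    by (auto simp: beam_group_nth intro!: state_eqI)
  show "beam_group a L (s + t) = beam_group a L s \<circ> beam_group a L t" for s t
    by (rule ext, rule state_eqI)
      (auto simp: beam_group_nth distrib_left cos_add sin_add algebra_simps)
  fix x :: "ell2 \<times> ell2"
  let ?M = "\<lambda>i. 4 * ((ell2_nth (fst x) i)\<^sup>2 + (ell2_nth (snd x) i)\<^sup>2)"
  show "((\<lambda>t. beam_group a L t x) \<longlongrightarrow> x) (at 0)"
  proof (rule state_tendstoI[where M = ?M])
    have c: "((\<lambda>t. cos (w * t)) \<longlongrightarrow> 1) (at 0)" "((\<lambda>t. sin (w * t)) \<longlongrightarrow> 0) (at 0)"
      "((\<lambda>t. - sin (w * t)) \<longlongrightarrow> 0) (at 0)" for w :: real
      by (auto intro!: tendsto_eq_intros)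
    show "((\<lambda>h. ell2_nth (fst (beam_group a L h x)) i) \<longlongrightarrow> ell2_nth (fst x) i) (at 0)" for i
      unfolding beam_group_nth by (rule tendsto_eq_intros c refl | simp)+
    show "((\<lambda>h. ell2_nth (snd (beam_group a L h x)) i) \<longlongrightarrow> ell2_nth (snd x) i) (at 0)" for i
      unfolding beam_group_nth by (rule tendsto_eq_intros c refl | simp)+
    show "summable ?M" by (intro summable_mult state_sq_summable)
    have "(cos u * v + sin u * w - v)\<^sup>2 + (- sin u * v + cos u * w - w)\<^sup>2 \<le> 4 * (v\<^sup>2 + w\<^sup>2)" for u v w :: real
    proof -
      have "(cos u * v + sin u * w - v)\<^sup>2 + (- sin u * v + cos u * w - w)\<^sup>2
          = ((cos u)\<^sup>2 + (sin u)\<^sup>2 + 1 - 2 * cos u) * (v\<^sup>2 + w\<^sup>2)" by algebra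
      also have "\<dots> \<le> 4 * (v\<^sup>2 + w\<^sup>2)"
      proof (rule mult_right_mono)
        have "- 1 \<le> cos u" by (rule cos_ge_minus_one)
        moreover have "(cos u)\<^sup>2 + (sin u)\<^sup>2 = 1" by simp
        ultimately show "(cos u)\<^sup>2 + (sin u)\<^sup>2 + 1 - 2 * cos u \<le> 4" by linarith
      qed simp
      finally show ?thesis .
    qed
    then show "\<forall>\<^sub>F h in at 0. \<forall>i. (ell2_nth (fst (beam_group a L h x)) i - ell2_nth (fst x) i)\<^sup>2
        + (ell2_nth (snd (beam_group a L h x)) i - ell2_nth (snd x) i)\<^sup>2 \<le> ?M i"
      unfolding beam_group_nth by (intro always_eventually allI)
  qed simp
qed

lemma rotation_derivs:
  fixes w v v' :: real
  shows "((\<lambda>h. (1 / h) * (cos (w * h) * v + sin (w * h) * v' - v)) \<longlongrightarrow> w * v') (at 0)"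
    and "((\<lambda>h. (1 / h) * (- sin (w * h) * v + cos (w * h) * v' - v')) \<longlongrightarrow> - w * v) (at 0)"
proof -
  have "((\<lambda>h. cos (w * h) * v + sin (w * h) * v') has_real_derivative w * v') (at 0)"
    by (auto intro!: derivative_eq_intros)
  then show "((\<lambda>h. (1 / h) * (cos (w * h) * v + sin (w * h) * v' - v)) \<longlongrightarrow> w * v') (at 0)"
    by (simp add: DERIV_def field_simps)
  have "((\<lambda>h. - sin (w * h) * v + cos (w * h) * v') has_real_derivative - w * v) (at 0)"
    by (auto intro!: derivative_eq_intros)
  then show "((\<lambda>h. (1 / h) * (- sin (w * h) * v + cos (w * h) * v' - v')) \<longlongrightarrow> - w * v) (at 0)"
    by (simp add: DERIV_def field_simps)
qed

lemma beam_quotient_nth: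
  "ell2_nth (fst ((1 / h) *\<^sub>R (beam_group a L h x - x))) i = (1 / h) *
     (cos (beam_freq a L (Suc i) * h) * ell2_nth (fst x) i + sin (beam_freq a L (Suc i) * h) * ell2_nth (snd x) i
       - ell2_nth (fst x) i)"
  "ell2_nth (snd ((1 / h) *\<^sub>R (beam_group a L h x - x))) i = (1 / h) *
     (- sin (beam_freq a L (Suc i) * h) * ell2_nth (fst x) i + cos (beam_freq a L (Suc i) * h) * ell2_nth (snd x) i
       - ell2_nth (snd x) i)"
  unfolding fst_scaleR snd_scaleR fst_diff snd_diff scaleR_ell2.rep_eq minus_ell2.rep_eq beam_group_nth
  by (rule refl)+

lemma rotation_quotient_bound:
  fixes w v v' h :: real
  assumes "h \<noteq> 0"
  shows "((1 / h) * (cos (w * h) * v + sin (w * h) * v' - v) - w * v')\<^sup>2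
       + ((1 / h) * (- sin (w * h) * v + cos (w * h) * v' - v') - - w * v)\<^sup>2 \<le> 10 * (w\<^sup>2 * (v\<^sup>2 + v'\<^sup>2))"
proof -
  define p where "p = (cos (w * h) - 1) / h"
  define q where "q = sin (w * h) / h - w"
  have arith: "A \<le> C \<Longrightarrow> B \<le> 4 * C \<Longrightarrow> 0 \<le> C \<Longrightarrow> A + B \<le> 10 * C" for A B C :: real by linarith
  have s: "\<bar>sin (w * h)\<bar> \<le> \<bar>w * h\<bar>" by (rule abs_sin_x_le_abs_x)
  have "cos (w * h) - 1 = - 2 * (sin (w * h / 2))\<^sup>2"
    using cos_double_sin[of "w * h / 2"] by simp
  then have "\<bar>cos (w * h) - 1\<bar> = 2 * (\<bar>sin (w * h / 2)\<bar> * \<bar>sin (w * h / 2)\<bar>)"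
    by (simp add: power2_eq_square)
  also have "\<dots> \<le> 2 * (\<bar>w * h / 2\<bar> * 1)"
    by (intro mult_left_mono mult_mono abs_sin_x_le_abs_x) auto
  finally have c: "\<bar>cos (w * h) - 1\<bar> \<le> \<bar>w * h\<bar>" by simp
  have p: "\<bar>p\<bar> \<le> \<bar>w\<bar>" using c assms by (simp add: p_def abs_mult field_simps)
  have "\<bar>sin (w * h) / h\<bar> \<le> \<bar>w\<bar>" using s assms by (simp add: abs_mult field_simps)
  then have q: "\<bar>q\<bar> \<le> \<bar>2 * w\<bar>" unfolding q_def by linarith
  have "p\<^sup>2 \<le> w\<^sup>2" using p by (simp add: abs_le_square_iff)
  moreover have "q\<^sup>2 \<le> (2 * w)\<^sup>2" using q by (simp only: abs_le_square_iff)
  moreover have "0 \<le> w\<^sup>2" by simp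
  ultimately have pq: "p\<^sup>2 + q\<^sup>2 \<le> 10 * w\<^sup>2"
    using arith[of "p\<^sup>2" "w\<^sup>2" "q\<^sup>2"] by (simp add: power_mult_distrib)
  have "(1 / h) * (cos (w * h) * v + sin (w * h) * v' - v) - w * v' = p * v + q * v'"
    "(1 / h) * (- sin (w * h) * v + cos (w * h) * v' - v') - - w * v = p * v' - q * v"
    using assms by (simp_all add: p_def q_def field_simps)
  then have "((1 / h) * (cos (w * h) * v + sin (w * h) * v' - v) - w * v')\<^sup>2
       + ((1 / h) * (- sin (w * h) * v + cos (w * h) * v' - v') - - w * v)\<^sup>2
     = (p * v + q * v')\<^sup>2 + (p * v' - q * v)\<^sup>2" by (simp only:)
  also have "\<dots> = (p\<^sup>2 + q\<^sup>2) * (v\<^sup>2 + v'\<^sup>2)" by algebra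
  also have "\<dots> \<le> (10 * w\<^sup>2) * (v\<^sup>2 + v'\<^sup>2)" by (intro mult_right_mono pq) simp
  finally show ?thesis by simp
qed

lemma beam_group_generated: "generates_group (beam_domain a L) (beam_A a L) (beam_group a L)"
  unfolding generates_group_def
proof (intro conjI allI iffI beam_group_C0)
  fix x y :: "ell2 \<times> ell2"
  assume lim: "((\<lambda>h. (1 / h) *\<^sub>R (beam_group a L h x - x)) \<longlongrightarrow> y) (at 0)"
  note bl1 = bounded_linear_compose[OF bounded_linear_ell2_nth bounded_linear_fst]
  note bl2 = bounded_linear_compose[OF bounded_linear_ell2_nth bounded_linear_snd]
  have y1: "ell2_nth (fst y) i = beam_freq a L (Suc i) * ell2_nth (snd x) i" for i
    by (rule tendsto_unique[OF _ bounded_linear.tendsto[OF bl1 lim]])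
      (simp, unfold beam_quotient_nth, rule rotation_derivs)
  have y2: "ell2_nth (snd y) i = - beam_freq a L (Suc i) * ell2_nth (fst x) i" for i
    by (rule tendsto_unique[OF _ bounded_linear.tendsto[OF bl2 lim]])
      (simp, unfold beam_quotient_nth, rule rotation_derivs)
  have "summable (\<lambda>i. (ell2_nth (fst y) i)\<^sup>2 + (ell2_nth (snd y) i)\<^sup>2)"
    by (rule state_sq_summable)
  then have xD: "x \<in> beam_domain a L"
    by (simp add: beam_domain_def case_prod_beta y1 y2 power_mult_distrib algebra_simps)
  moreover have "beam_A a L x = y"
    by (rule state_eqI) (simp_all add: beam_A_nth[OF xD] y1 y2)
  ultimately show "x \<in> beam_domain a L" "beam_A a L x = y" by auto
next
  fix x y :: "ell2 \<times> ell2"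
  assume "x \<in> beam_domain a L \<and> beam_A a L x = y"
  then have xD: "x \<in> beam_domain a L" and y: "y = beam_A a L x" by auto
  let ?M = "\<lambda>i. 10 * ((beam_freq a L (Suc i))\<^sup>2 * ((ell2_nth (fst x) i)\<^sup>2 + (ell2_nth (snd x) i)\<^sup>2))"
  show "((\<lambda>h. (1 / h) *\<^sub>R (beam_group a L h x - x)) \<longlongrightarrow> y) (at 0)"
  proof (rule state_tendstoI[where M = ?M])
    show "summable ?M" using xD by (intro summable_mult) (simp add: beam_domain_def case_prod_beta)
    show "\<forall>\<^sub>F h in at 0. \<forall>i.
        (ell2_nth (fst ((1 / h) *\<^sub>R (beam_group a L h x - x))) i - ell2_nth (fst y) i)\<^sup>2
      + (ell2_nth (snd ((1 / h) *\<^sub>R (beam_group a L h x - x))) i - ell2_nth (snd y) i)\<^sup>2 \<le> ?M i"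
      unfolding y beam_quotient_nth beam_A_nth[OF xD] eventually_at_filter
      by (intro always_eventually allI impI rotation_quotient_bound)
  qed (simp, unfold y beam_quotient_nth beam_A_nth[OF xD], (rule rotation_derivs)+)
qed

lemma beam_domain_dense: "\<exists>X. (\<forall>n. X n \<in> beam_domain a L) \<and> X \<longlonglongrightarrow> x"
proof -
  have trunc: "summable (\<lambda>i. (if i < n then ell2_nth \<xi> i else 0)\<^sup>2)" for n and \<xi> :: ell2
    by (rule summable_sq_bound[OF ell2_summable[of \<xi>]]) simp
  define P where "P = (\<lambda>n \<xi>. Abs_ell2 (\<lambda>i. if i < n then ell2_nth \<xi> i else 0))"
  have P: "ell2_nth (P n \<xi>) i = (if i < n then ell2_nth \<xi> i else 0)" for n \<xi> i
    by (simp add: P_def ell2_nth_Abs[OF trunc])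
  have conv: "(\<lambda>n. P n \<xi>) \<longlonglongrightarrow> \<xi>" for \<xi>
  proof -
    have "(norm (P n \<xi> - \<xi>))\<^sup>2 = (\<Sum>i. (ell2_nth \<xi> (i + n))\<^sup>2)" for n
    proof -
      have "(norm (P n \<xi> - \<xi>))\<^sup>2 = (\<Sum>i. (ell2_nth (P n \<xi> - \<xi>) (i + n))\<^sup>2) + (\<Sum>i<n. (ell2_nth (P n \<xi> - \<xi>) i)\<^sup>2)"
        unfolding norm_ell2_sq by (rule suminf_split_initial_segment) simp
      then show ?thesis by (simp add: minus_ell2.rep_eq P)
    qed
    then have "(\<lambda>n. (norm (P n \<xi> - \<xi>))\<^sup>2) \<longlonglongrightarrow> 0"
      using suminf_exist_split2[OF ell2_summable[of \<xi>]] by simp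
    then have "(\<lambda>n. sqrt ((norm (P n \<xi> - \<xi>))\<^sup>2)) \<longlonglongrightarrow> sqrt 0" by (rule tendsto_real_sqrt)
    then have "(\<lambda>n. norm (P n \<xi> - \<xi>)) \<longlonglongrightarrow> 0" by simp
    then show ?thesis using Lim_null tendsto_norm_zero_iff by blast
  qed
  have "(P n (fst x), P n (snd x)) \<in> beam_domain a L" for n
    unfolding beam_domain_def mem_Collect_eq prod.case
    by (rule summable_finite[of "{..<n}"]) (auto simp: P)
  moreover have "(\<lambda>n. (P n (fst x), P n (snd x))) \<longlonglongrightarrow> (fst x, snd x)"
    by (intro tendsto_Pair conv)
  ultimately show ?thesis by (intro exI[of _ "\<lambda>n. (P n (fst x), P n (snd x))"]) auto
qed

lemma generates_group_orbit:
  assumes S: "generates_group D A S" and x: "x \<in> D"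
  shows "S t x \<in> D" and "((\<lambda>t. S t x) has_vector_derivative A (S t x)) (at t)"
proof -
  have add: "S (s + t) = S s \<circ> S t" and bl: "bounded_linear (S t)" for s t
    using S by (auto simp: generates_group_def C0_group_def)
  have "((\<lambda>h. (1 / h) *\<^sub>R (S h x - x)) \<longlongrightarrow> A x) (at 0)"
    using S x by (auto simp: generates_group_def)
  then have "((\<lambda>h. S t ((1 / h) *\<^sub>R (S h x - x))) \<longlongrightarrow> S t (A x)) (at 0)"
    by (rule bounded_linear.tendsto[OF bl])
  moreover have "S t ((1 / h) *\<^sub>R (S h x - x)) = (1 / h) *\<^sub>R (S h (S t x) - S t x)" for h
  proof -
    have "S t (S h x) = S h (S t x)" using add[of t h] add[of h t] by (metis add.commute comp_apply)
    then show ?thesis using bl[of t] by (simp add: bounded_linear.linear linear_cmul linear_diff)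
  qed
  ultimately have lim: "((\<lambda>h. (1 / h) *\<^sub>R (S h (S t x) - S t x)) \<longlongrightarrow> S t (A x)) (at 0)" by simp
  then have D: "S t x \<in> D" and A: "A (S t x) = S t (A x)"
    using S by (auto simp: generates_group_def)
  show "S t x \<in> D" by (fact D)
  have "((\<lambda>h. norm ((1 / h) *\<^sub>R (S h (S t x) - S t x) - A (S t x))) \<longlongrightarrow> 0) (at 0)"
    using lim unfolding A by (intro tendsto_norm_zero) (simp add: LIM_zero_iff)
  moreover have "\<forall>\<^sub>F h in at 0. norm ((1 / h) *\<^sub>R (S h (S t x) - S t x) - A (S t x))
      = norm (S (t + h) x - S t x - h *\<^sub>R A (S t x)) / norm h"
    unfolding eventually_at_filter
  proof (intro always_eventually allI impI)
    fix h :: real assume h: "h \<noteq> 0"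
    have "S (t + h) x - S t x - h *\<^sub>R A (S t x) = h *\<^sub>R ((1 / h) *\<^sub>R (S h (S t x) - S t x) - A (S t x))"
      using h add[of h t] by (simp add: add.commute scaleR_diff_right)
    then show "norm ((1 / h) *\<^sub>R (S h (S t x) - S t x) - A (S t x))
      = norm (S (t + h) x - S t x - h *\<^sub>R A (S t x)) / norm h"
      using h by simp
  qed
  ultimately have "((\<lambda>h. norm (S (t + h) x - S t x - h *\<^sub>R A (S t x)) / norm h) \<longlongrightarrow> 0) (at 0)"
    by (rule Lim_transform_eventually)
  then show "((\<lambda>t. S t x) has_vector_derivative A (S t x)) (at t)"
    unfolding has_vector_derivative_def has_derivative_at
    by (simp add: bounded_linear_scaleR_left)
qed

lemma rotation_unique:
  fixes f g :: "real \<Rightarrow> real"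
  assumes f: "\<And>t. (f has_real_derivative w * g t) (at t)"
    and g: "\<And>t. (g has_real_derivative - w * f t) (at t)"
  shows "f t = cos (w * t) * f 0 + sin (w * t) * g 0"
    and "g t = - sin (w * t) * f 0 + cos (w * t) * g 0"
proof -
  define u where "u = (\<lambda>t. cos (w * t) * f t - sin (w * t) * g t)"
  define v where "v = (\<lambda>t. sin (w * t) * f t + cos (w * t) * g t)"
  have "(u has_real_derivative 0) (at t)" for t
    unfolding u_def by (rule derivative_eq_intros f g refl | simp add: algebra_simps)+
  then have u: "u t = u 0" by (intro DERIV_isconst_all) auto
  have "(v has_real_derivative 0) (at t)" for t
    unfolding v_def by (rule derivative_eq_intros f g refl | simp add: algebra_simps)+
  then have v: "v t = v 0" by (intro DERIV_isconst_all) auto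
  have one: "(cos (w * t))\<^sup>2 + (sin (w * t))\<^sup>2 = 1" by simp
  have "cos (w * t) * u t + sin (w * t) * v t = ((cos (w * t))\<^sup>2 + (sin (w * t))\<^sup>2) * f t"
    unfolding u_def v_def by algebra
  then show "f t = cos (w * t) * f 0 + sin (w * t) * g 0"
    unfolding u v one by (simp add: u_def v_def)
  have "- sin (w * t) * u t + cos (w * t) * v t = ((cos (w * t))\<^sup>2 + (sin (w * t))\<^sup>2) * g t"
    unfolding u_def v_def by algebra
  then show "g t = - sin (w * t) * f 0 + cos (w * t) * g 0"
    unfolding u v one by (simp add: u_def v_def)
qed

lemma beam_group_unique:
  assumes S: "generates_group (beam_domain a L) (beam_A a L) S"
  shows "S = beam_group a L"
proof (rule ext, rule ext)
  fix t and x :: "ell2 \<times> ell2"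
  note bl1 = bounded_linear_compose[OF bounded_linear_ell2_nth bounded_linear_fst]
  note bl2 = bounded_linear_compose[OF bounded_linear_ell2_nth bounded_linear_snd]
  have S0: "S 0 = id" and blS: "bounded_linear (S t)"
    using S by (auto simp: generates_group_def C0_group_def)
  have on_domain: "S t x = beam_group a L t x" if x: "x \<in> beam_domain a L" for x
  proof -
    note orb = generates_group_orbit[OF S x]
    have f: "((\<lambda>t. ell2_nth (fst (S t x)) i) has_real_derivative
        beam_freq a L (Suc i) * ell2_nth (snd (S t x)) i) (at t)" for i t
      using bounded_linear.has_vector_derivative[OF bl1 orb(2)]
      unfolding beam_A_nth[OF orb(1)] has_real_derivative_iff_has_vector_derivative .
    have g: "((\<lambda>t. ell2_nth (snd (S t x)) i) has_real_derivative
        - beam_freq a L (Suc i) * ell2_nth (fst (S t x)) i) (at t)" for i t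
      using bounded_linear.has_vector_derivative[OF bl2 orb(2)]
      unfolding beam_A_nth[OF orb(1)] has_real_derivative_iff_has_vector_derivative .
    show ?thesis
      by (rule state_eqI; unfold beam_group_nth)
        (use rotation_unique[OF f g] S0 in auto)
  qed
  obtain X where X: "\<And>n. X n \<in> beam_domain a L" "X \<longlonglongrightarrow> x"
    using beam_domain_dense by blast
  have blG: "bounded_linear (beam_group a L t)"
    using beam_group_C0 by (auto simp: C0_group_def)
  have "(\<lambda>n. S t (X n)) \<longlonglongrightarrow> beam_group a L t x"
    using bounded_linear.tendsto[OF blG X(2)] by (simp add: on_domain X(1))
  then show "S t x = beam_group a L t x"
    using bounded_linear.tendsto[OF blS X(2)] LIMSEQ_unique by blast
qed

lemma exp_group_beam: "exp_group (beam_domain a L) (beam_A a L) = beam_group a L"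
  unfolding exp_group_def by (rule the_equality, rule beam_group_generated, rule beam_group_unique)

lemma beam_b_full:
  assumes "a > 0" "L > 0" "n \<ge> 1" "j \<ge> 1"
  shows "beam_b a L 0 L n j = (if n = j then - (1 / a) else 0)"
proof -
  have d: "deriv (beam_mode L m) z = sqrt (2 / L) * (pi * real m / L) * cos (pi * real m * z / L)" for m z
  proof (rule DERIV_imp_deriv)
    show "(beam_mode L m has_real_derivative sqrt (2 / L) * (pi * real m / L) * cos (pi * real m * z / L)) (at z)"
      unfolding beam_mode_def using assms by (auto intro!: derivative_eq_intros)
  qed
  define I where "I = integral {0..L} (\<lambda>z. cos (pi * real j * z / L) * cos (pi * real n * z / L))"
  have I: "I = (if n = j then L / 2 else 0)"
  proof -
    have "((\<lambda>z. cos (pi * real j * z / L) * cos (pi * real n * z / L)) has_integral (if n = j then L / 2 else 0)) {0..L}"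
    proof (cases "n = j")
      case True
      define F where "F = (\<lambda>z. z / 2 + sin (2 * (pi * real n * z / L)) * L / (4 * pi * real n))"
      have "((\<lambda>z. cos (pi * real j * z / L) * cos (pi * real n * z / L)) has_integral F L - F 0) {0..L}"
      proof (rule fundamental_theorem_of_calculus)
        fix z
        have "(F has_real_derivative 1 / 2 + cos (2 * (pi * real n * z / L)) / 2) (at z within {0..L})"
          unfolding F_def using assms by (auto intro!: derivative_eq_intros simp: field_simps)
        also have "1 / 2 + cos (2 * (pi * real n * z / L)) / 2 = cos (pi * real j * z / L) * cos (pi * real n * z / L)"
          unfolding cos_double_cos True by (simp add: power2_eq_square diff_divide_distrib)
        finally show "(F has_vector_derivative cos (pi * real j * z / L) * cos (pi * real n * z / L)) (at z within {0..L})"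
          by (simp add: has_real_derivative_iff_has_vector_derivative)
      qed (use assms in simp)
      moreover have "sin (2 * (pi * real n * L / L)) = 0"
        using sin_npi[of "2 * n"] assms by (simp add: mult_ac)
      then have "F L - F 0 = L / 2" using assms by (simp add: F_def)
      ultimately show ?thesis using True by simp
    next
      case False
      define p where "p = real j - real n"
      define q where "q = real j + real n"
      have p: "p \<noteq> 0" and q: "q \<noteq> 0" using False assms by (auto simp: p_def q_def)
      define F where "F = (\<lambda>z. sin (pi * p * z / L) * L / (2 * pi * p) + sin (pi * q * z / L) * L / (2 * pi * q))"
      have "((\<lambda>z. cos (pi * real j * z / L) * cos (pi * real n * z / L)) has_integral F L - F 0) {0..L}"
      proof (rule fundamental_theorem_of_calculus)
        fix z
        have "(F has_real_derivative cos (pi * p * z / L) / 2 + cos (pi * q * z / L) / 2) (at z within {0..L})"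
          unfolding F_def using assms p q by (auto intro!: derivative_eq_intros simp: field_simps)
        also have "cos (pi * p * z / L) / 2 + cos (pi * q * z / L) / 2 = cos (pi * real j * z / L) * cos (pi * real n * z / L)"
          unfolding cos_times_cos p_def q_def by (simp add: add_divide_distrib diff_divide_distrib ring_distribs)
        finally show "(F has_vector_derivative cos (pi * real j * z / L) * cos (pi * real n * z / L)) (at z within {0..L})"
          by (simp add: has_real_derivative_iff_has_vector_derivative)
      qed (use assms in simp)
      moreover have "pi * p * L / L = pi * real j - pi * real n" "pi * q * L / L = pi * real j + pi * real n"
        using assms by (simp_all add: p_def q_def field_simps)
      then have "sin (pi * p * L / L) = 0" "sin (pi * q * L / L) = 0"
        by (simp_all add: sin_diff sin_add)
      then have "F L - F 0 = 0" by (simp add: F_def)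
      ultimately show ?thesis using False by simp
    qed
    then show ?thesis unfolding I_def by (rule integral_unique)
  qed
  have "(\<lambda>z. deriv (beam_mode L j) z * deriv (beam_mode L n) z)
    = (\<lambda>z. (2 / L * (pi * real j / L) * (pi * real n / L)) *\<^sub>R (cos (pi * real j * z / L) * cos (pi * real n * z / L)))"
    unfolding d using assms by (intro ext) (simp add: real_sqrt_divide field_simps)
  then have "integral {0..L} (\<lambda>z. deriv (beam_mode L j) z * deriv (beam_mode L n) z)
    = (2 / L * (pi * real j / L) * (pi * real n / L)) *\<^sub>R I"
    unfolding I_def by (simp only: integral_cmul)
  then show ?thesis
    unfolding beam_b_def using assms
    by (cases "n = j") (simp_all add: I beam_freq_def power2_eq_square field_simps)
qed

lemma beam_B_full:
  assumes "a > 0" "L > 0"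
  shows "beam_B a L 0 L (\<xi>, \<eta>) = (0, - (1 / a) *\<^sub>R \<xi>)"
proof -
  have "(\<Sum>j. beam_b a L 0 L (Suc i) (Suc j) * ell2_nth \<xi> j) = - (1 / a) * ell2_nth \<xi> i" for i
    by (subst suminf_finite[of "{i}"]) (auto simp: beam_b_full[OF assms])
  moreover have "summable (\<lambda>i. (- (1 / a) * ell2_nth \<xi> i)\<^sup>2)"
    by (intro summable_sq_cmult ell2_summable)
  ultimately have "mat_vec (beam_b a L 0 L) \<xi> = - (1 / a) *\<^sub>R \<xi>"
    by (intro ell2_eqI) (simp add: mat_vec_def ell2_nth_Abs scaleR_ell2.rep_eq uminus_ell2.rep_eq)
  then show ?thesis by (simp add: beam_B_def)
qed

end

(* The group generated by A is isometric and B has norm 1/a, so that by Cauchy-Schwarz the integral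
   operator in the variation-of-constants formula contracts with factor q = sqrt T * r / a < 1.
   Hence sup |x| <= |x0| / (1 - q), and the difference between x(T) and its first-order Volterra
   approximation is at most q * q * |x0| / (1 - q). The first-order approximation is an affine image
   of the control under a map with linear part of norm at most |x0| * sqrt T / a. *)
theory Submission
  imports Defs
begin

section \<open>Widths of sets close to an affine image of another set\<close>

text \<open>For \<open>C > 0\<close> the map \<open>z \<mapsto> C * z + \<rho>\<close> is an order
  isomorphism of \<open>ereal\<close>, so it commutes with infima. Non-emptiness of \<open>I\<close>
  covers \<open>C = 0\<close>: an empty infimum is infinite, but \<open>ereal\<close> multiplication
  sends zero times infinity to zero.\<close>

lemma INF_ereal_affine_le:
  fixes f :: "'a \<Rightarrow> ereal"
  assumes "I \<noteq> {}" "0 \<le> C"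
  shows "(INF i\<in>I. ereal C * f i + ereal \<rho>) \<le> ereal C * (INF i\<in>I. f i) + ereal \<rho>"
proof (cases "C = 0")
  case True
  then show ?thesis using assms(1) by (simp flip: zero_ereal_def)
next
  case False
  then have C: "0 < C" using assms(2) by simp
  have galois: "m \<le> ereal C * z + ereal \<rho> \<longleftrightarrow> (m - ereal \<rho>) / ereal C \<le> z" for m z
    using C by (cases m; cases z) (auto simp: field_simps)
  show ?thesis unfolding galois
    by (rule INF_greatest) (unfold galois[symmetric], rule INF_lower)
qed

text \<open>This isolates the width argument from the control theory. An affine subspace
  \<open>W\<close> near \<open>K\<close> is transported by
  \<open>v \<mapsto> c\<^sub>0 + \<Lambda> v\<close>; distances grow at most by the factor
  \<open>C\<close>, and replacing \<open>x\<close> by its approximation costs a further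
  \<open>\<rho>\<close>.\<close>

lemma kolmogorov_width_linear_approx:
  fixes \<Lambda> :: "'a::real_normed_vector \<Rightarrow> 'b::real_normed_vector"
  assumes lin: "linear \<Lambda>" and bound: "\<And>v. norm (\<Lambda> v) \<le> C * norm v" and C: "0 \<le> C"
    and Z: "0 \<in> Z"
    and approx: "\<And>x. x \<in> S \<Longrightarrow> \<exists>u\<in>K. norm (x - (c\<^sub>0 + \<Lambda> u)) \<le> \<rho>"
  shows "kolmogorov_width UNIV n S \<le> ereal C * kolmogorov_width Z n K + ereal \<rho>"
proof -
  define F where "F = (\<lambda>W. SUP u\<in>K. INF v\<in>W. ereal (norm (u - v)))"
  \<comment> \<open>Needed to pull \<open>C\<close> out of the outer infimum when
    \<open>C = 0\<close>, a case that occurs for a zero initial state. The empty spanning set gives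
    the subspace \<open>{0}\<close> for every \<open>n\<close>.\<close>
  have ne: "affine_subspaces n Z \<noteq> {}"
  proof -
    have "{0} \<in> affine_subspaces n Z"
      unfolding affine_subspaces_def mem_Collect_eq using Z
      by (intro bexI[of _ 0] exI[of _ "{0}"]) (auto simp: subspace_def intro!: exI[of _ "{}"])
    then show ?thesis by blast
  qed
  have step: "kolmogorov_width UNIV n S \<le> ereal C * F W + ereal \<rho>" if W: "W \<in> affine_subspaces n Z" for W
  proof -
    obtain c E where E: "finite E" "card E \<le> n" and Weq: "W = (+) c ` span E"
      using W unfolding affine_subspaces_def by auto
    have W_ne: "W \<noteq> {}" unfolding Weq using span_zero by blast
    define W' where "W' = (+) (c\<^sub>0 + \<Lambda> c) ` span (\<Lambda> ` E)"
    have W': "W' \<in> affine_subspaces n UNIV"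
      unfolding affine_subspaces_def W'_def mem_Collect_eq
      using E card_image_le[OF E(1), of \<Lambda>]
      by (intro bexI[of _ "c\<^sub>0 + \<Lambda> c"] exI[of _ "span (\<Lambda> ` E)"])
        (auto intro!: exI[of _ "\<Lambda> ` E"])
    have "kolmogorov_width UNIV n S \<le> (SUP x\<in>S. INF y\<in>W'. ereal (norm (x - y)))"
      unfolding kolmogorov_width_def by (rule INF_lower[OF W'])
    also have "\<dots> \<le> ereal C * F W + ereal \<rho>"
    proof (rule SUP_least)
      fix x assume "x \<in> S"
      then obtain u where u: "u \<in> K" "norm (x - (c\<^sub>0 + \<Lambda> u)) \<le> \<rho>" using approx by blast
      have "(INF y\<in>W'. ereal (norm (x - y))) \<le> ereal C * ereal (norm (u - v)) + ereal \<rho>" if v: "v \<in> W" for v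
      proof -
        obtain e where e: "e \<in> span E" "v = c + e" using v unfolding Weq by blast
        have "c\<^sub>0 + \<Lambda> v \<in> W'"
          unfolding W'_def e(2) linear_add[OF lin] linear_span_image[OF lin] using e(1)
          by (auto simp: add.assoc)
        then have "(INF y\<in>W'. ereal (norm (x - y))) \<le> ereal (norm (x - (c\<^sub>0 + \<Lambda> v)))"
          by (rule INF_lower)
        also have "norm (x - (c\<^sub>0 + \<Lambda> v)) \<le> norm (x - (c\<^sub>0 + \<Lambda> u)) + norm (\<Lambda> (u - v))"
          using norm_triangle_ineq[of "x - (c\<^sub>0 + \<Lambda> u)" "\<Lambda> (u - v)"] by (simp add: linear_diff[OF lin] diff_diff_eq)
        also have "\<dots> \<le> C * norm (u - v) + \<rho>" using u(2) bound[of "u - v"] by linarith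
        finally show ?thesis by simp
      qed
      then have "(INF y\<in>W'. ereal (norm (x - y)))
          \<le> (INF v\<in>W. ereal C * ereal (norm (u - v)) + ereal \<rho>)"
        by (rule INF_greatest)
      also have "\<dots> \<le> ereal C * (INF v\<in>W. ereal (norm (u - v))) + ereal \<rho>"
        by (rule INF_ereal_affine_le[OF W_ne C])
      also have "ereal C * (INF v\<in>W. ereal (norm (u - v))) \<le> ereal C * F W"
        unfolding F_def using C u(1) by (intro ereal_mult_left_mono SUP_upper) auto
      finally show "(INF y\<in>W'. ereal (norm (x - y))) \<le> ereal C * F W + ereal \<rho>"
        by (simp add: add_right_mono)
    qed
    finally show ?thesis .
  qed
  have "kolmogorov_width UNIV n S \<le> (INF W\<in>affine_subspaces n Z. ereal C * F W + ereal \<rho>)"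
    by (rule INF_greatest) (rule step)
  also have "\<dots> \<le> ereal C * (INF W\<in>affine_subspaces n Z. F W) + ereal \<rho>"
    by (rule INF_ereal_affine_le[OF ne C])
  finally show ?thesis unfolding kolmogorov_width_def F_def .
qed

section \<open>Integrals of a vector function against a square-integrable control\<close>

text \<open>\<open>rep_L2\<close> chooses an arbitrary representative of each class, so algebraic
  identities carry over only almost everywhere.\<close>

lemma rep_L2_add: "AE s in lborel. rep_L2 (u + v) s = rep_L2 u s + rep_L2 v s"
proof -
  have "L2_rel (rep_L2 (abs_L2 (\<lambda>s. rep_L2 u s + rep_L2 v s))) (\<lambda>s. rep_L2 u s + rep_L2 v s)"
    using L2_rel_rep[of u] L2_rel_rep[of v]
    by (intro L2_rel_rep_abs) (auto simp: L2_rel_def intro!: integrable_sq_add)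
  then show ?thesis by (simp add: plus_L2_def L2_rel_def)
qed

lemma rep_L2_scaleR: "AE s in lborel. rep_L2 (c *\<^sub>R u) s = c * rep_L2 u s"
proof -
  have "L2_rel (rep_L2 (abs_L2 (\<lambda>s. c * rep_L2 u s))) (\<lambda>s. c * rep_L2 u s)"
    using L2_rel_rep[of u]
    by (intro L2_rel_rep_abs) (auto simp: L2_rel_def power_mult_distrib)
  then show ?thesis by (simp add: scaleR_L2_def L2_rel_def)
qed

lemma rep_L2_measurable [measurable]: "rep_L2 u \<in> borel_measurable borel"
  using L2_rel_rep[of u] by (simp add: L2_rel_def)

text \<open>Cauchy-Schwarz in the inner product space \<open>L2\<close>, applied to the classes of
  the indicator of \<open>{0..t}\<close>, of norm \<open>sqrt t\<close>, and of the absolute value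
  of \<open>u\<close>, of norm \<open>norm u\<close>.\<close>

lemma L2_set_integral_abs:
  assumes "0 \<le> t"
  shows "set_integrable lborel {0..t} (rep_L2 u)"
    and "(LINT s:{0..t}|lborel. \<bar>rep_L2 u s\<bar>) \<le> sqrt t * norm u"
proof -
  define f where "f = (\<lambda>s. \<bar>rep_L2 u s\<bar>)"
  define g where "g = (indicat_real {0..t})"
  \<comment> \<open>An indicator is its own square, so its squared norm is the length
    \<open>t\<close>.\<close>
  have sq: "(\<lambda>s. (g s)\<^sup>2) = g" by (auto simp: g_def indicator_def)
  have f: "L2_rel f f" using L2_rel_rep[of u] by (simp add: L2_rel_def f_def)
  have gint: "integrable lborel g" "(LINT s|lborel. g s) = t"
    using assms by (simp_all add: g_def)
  have g: "L2_rel g g"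
    unfolding L2_rel_def sq using gint by (simp add: g_def)
  have ff: "inner (abs_L2 f) (abs_L2 f) = inner u u"
    unfolding inner_L2.abs_eq[OF f f] inner_L2.rep_eq[of u u] by (simp add: f_def)
  have gg: "inner (abs_L2 g) (abs_L2 g) = t"
    using gint sq by (simp add: inner_L2.abs_eq[OF g g] power2_eq_square)
  have "(LINT s:{0..t}|lborel. \<bar>rep_L2 u s\<bar>) = inner (abs_L2 g) (abs_L2 f)"
    unfolding inner_L2.abs_eq[OF g f] by (simp add: set_lebesgue_integral_def f_def g_def)
  also have "\<dots> \<le> norm (abs_L2 g) * norm (abs_L2 f)" by (rule norm_cauchy_schwarz)
  also have "\<dots> = sqrt t * norm u" by (simp add: norm_eq_sqrt_inner ff gg)
  finally show "(LINT s:{0..t}|lborel. \<bar>rep_L2 u s\<bar>) \<le> sqrt t * norm u" .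
  show "set_integrable lborel {0..t} (rep_L2 u)"
    using integrable_sq_prod[of g "rep_L2 u"] g L2_rel_rep[of u]
    by (simp add: set_integrable_def L2_rel_def g_def)
qed

text \<open>The factor is enlarged from \<open>sqrt t\<close> to \<open>sqrt T\<close> so that one
  contraction constant serves all times up to \<open>T\<close>.\<close>

lemma L2_control_integral_bound:
  fixes g :: "real \<Rightarrow> 'h::{banach, second_countable_topology}"
  assumes t: "0 \<le> t" "t \<le> T" and g: "\<And>s. s \<in> {0..t} \<Longrightarrow> norm (g s) \<le> N"
    and int: "set_integrable lborel {0..t} (\<lambda>s. rep_L2 u s *\<^sub>R g s)"
  shows "norm (LINT s:{0..t}|lborel. rep_L2 u s *\<^sub>R g s) \<le> N * (sqrt T * norm u)"
proof -
  have N: "0 \<le> N" using g[of 0] t order_trans[OF norm_ge_zero] by auto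
  have "norm (LINT s:{0..t}|lborel. rep_L2 u s *\<^sub>R g s)
      \<le> (LINT s:{0..t}|lborel. norm (rep_L2 u s *\<^sub>R g s))"
    by (rule set_integral_norm_bound[OF int])
  also have "\<dots> \<le> (LINT s:{0..t}|lborel. N * \<bar>rep_L2 u s\<bar>)"
  proof (rule set_integral_mono)
    show "set_integrable lborel {0..t} (\<lambda>s. norm (rep_L2 u s *\<^sub>R g s))"
      using int by (rule set_integrable_norm)
    show "set_integrable lborel {0..t} (\<lambda>s. N * \<bar>rep_L2 u s\<bar>)"
      using L2_set_integral_abs(1)[OF t(1)] by (intro set_integrable_mult_right set_integrable_abs)
    show "norm (rep_L2 u s *\<^sub>R g s) \<le> N * \<bar>rep_L2 u s\<bar>" if "s \<in> {0..t}" for s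
      using mult_left_mono[OF g[OF that], of "\<bar>rep_L2 u s\<bar>"] by (simp add: mult.commute)
  qed
  also have "\<dots> = N * (LINT s:{0..t}|lborel. \<bar>rep_L2 u s\<bar>)" by simp
  also have "\<dots> \<le> N * (sqrt t * norm u)"
    by (rule mult_left_mono[OF L2_set_integral_abs(2)[OF t(1)] N])
  also have "\<dots> \<le> N * (sqrt T * norm u)"
    using t N by (intro mult_left_mono mult_right_mono) auto
  finally show ?thesis .
qed

text \<open>A continuous \<open>g\<close> is bounded on the compact interval, so the integrand is
  dominated by a multiple of the control, which is integrable there.\<close>

lemma L2_control_set_integrable:
  fixes g :: "real \<Rightarrow> 'h::{banach, second_countable_topology}"
  assumes "0 \<le> t" and g: "continuous_on {0..t} g"
  shows "set_integrable lborel {0..t} (\<lambda>s. rep_L2 u s *\<^sub>R g s)"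
proof -
  obtain N where N: "\<And>s. s \<in> {0..t} \<Longrightarrow> norm (g s) \<le> N"
    using compact_imp_bounded[OF compact_continuous_image[OF g compact_Icc]]
    unfolding bounded_iff by blast
  have "(\<lambda>s. indicator {0..t} s *\<^sub>R g s) \<in> borel_measurable borel"
    using g by (intro borel_measurable_continuous_on_indicator) auto
  from borel_measurable_scaleR[OF rep_L2_measurable[of u] this]
  have meas: "(\<lambda>s. indicator {0..t} s *\<^sub>R (rep_L2 u s *\<^sub>R g s)) \<in> borel_measurable lborel"
    by (simp add: measurable_lborel1 scaleR_left_commute del: scaleR_scaleR)
  have "integrable lborel (\<lambda>s. N * (indicator {0..t} s *\<^sub>R rep_L2 u s))"
    using L2_set_integral_abs(1)[OF assms(1)] unfolding set_integrable_def by (rule integrable_mult_right)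
  then show ?thesis
    unfolding set_integrable_def
  proof (rule Bochner_Integration.integrable_bound[OF _ meas], intro AE_I2)
    fix s
    show "norm (indicator {0..t} s *\<^sub>R (rep_L2 u s *\<^sub>R g s)) \<le> norm (N * (indicator {0..t} s *\<^sub>R rep_L2 u s))"
    proof (cases "s \<in> {0..t}")
      case True
      have "norm (g s) \<le> \<bar>N\<bar>" using N[OF True] by linarith
      from mult_left_mono[OF this, of "\<bar>rep_L2 u s\<bar>"] show ?thesis
        using True by (simp add: abs_mult mult.commute)
    qed simp
  qed
qed

lemma linear_L2_control_integral:
  fixes g :: "real \<Rightarrow> 'h::{banach, second_countable_topology}"
  assumes "0 \<le> t" and g: "continuous_on {0..t} g"
  shows "linear (\<lambda>u. LINT s:{0..t}|lborel. rep_L2 u s *\<^sub>R g s)"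
proof (rule linearI)
  note int = L2_control_set_integrable[OF assms]
  have meas: "(\<lambda>s. indicator {0..t} s *\<^sub>R (rep_L2 u s *\<^sub>R g s)) \<in> borel_measurable lborel" for u
    using int[of u] unfolding set_integrable_def by (rule borel_measurable_integrable)
  fix u v :: L2 and c :: real
  have "(LINT s:{0..t}|lborel. rep_L2 (u + v) s *\<^sub>R g s)
      = (LINT s|lborel. indicator {0..t} s *\<^sub>R (rep_L2 u s *\<^sub>R g s) + indicator {0..t} s *\<^sub>R (rep_L2 v s *\<^sub>R g s))"
    unfolding set_lebesgue_integral_def using rep_L2_add[of u v]
    by (intro integral_cong_AE meas borel_measurable_add) (auto simp: algebra_simps elim!: AE_mp)
  also have "\<dots> = (LINT s:{0..t}|lborel. rep_L2 u s *\<^sub>R g s) + (LINT s:{0..t}|lborel. rep_L2 v s *\<^sub>R g s)"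
    using int unfolding set_lebesgue_integral_def set_integrable_def by (intro Bochner_Integration.integral_add)
  finally show "(LINT s:{0..t}|lborel. rep_L2 (u + v) s *\<^sub>R g s)
      = (LINT s:{0..t}|lborel. rep_L2 u s *\<^sub>R g s) + (LINT s:{0..t}|lborel. rep_L2 v s *\<^sub>R g s)" .
  have "(LINT s:{0..t}|lborel. rep_L2 (c *\<^sub>R u) s *\<^sub>R g s)
      = (LINT s|lborel. c *\<^sub>R (indicator {0..t} s *\<^sub>R (rep_L2 u s *\<^sub>R g s)))"
    unfolding set_lebesgue_integral_def using rep_L2_scaleR[of c u]
    by (intro integral_cong_AE meas borel_measurable_scaleR borel_measurable_const)
      (auto simp: mult_ac elim!: AE_mp)
  also have "\<dots> = c *\<^sub>R (LINT s:{0..t}|lborel. rep_L2 u s *\<^sub>R g s)"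
    unfolding set_lebesgue_integral_def by (rule integral_scaleR_right)
  finally show "(LINT s:{0..t}|lborel. rep_L2 (c *\<^sub>R u) s *\<^sub>R g s)
      = c *\<^sub>R (LINT s:{0..t}|lborel. rep_L2 u s *\<^sub>R g s)" .
qed

section \<open>Isometric groups and the first-order Volterra approximation\<close>

text \<open>Strong continuity concerns a fixed vector only. Joint continuity follows from \<open>G t
  x - G t\<^sub>0 x\<^sub>0 = G t (x - x\<^sub>0) + G t\<^sub>0 (G (t - t\<^sub>0) x\<^sub>0 -
  x\<^sub>0)\<close>, where isometry removes the outer group operators from the norms.\<close>

lemma continuous_on_isometric_C0_group:
  fixes G :: "real \<Rightarrow> 'h::real_normed_vector \<Rightarrow> 'h"
  assumes G: "C0_group G" and iso: "\<And>t x. norm (G t x) = norm x"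
    and f: "continuous_on S f" and y: "continuous_on S y"
  shows "continuous_on S (\<lambda>s. G (f s) (y s))"
  unfolding continuous_on_def
proof
  fix s\<^sub>0 assume s0: "s\<^sub>0 \<in> S"
  let ?F = "at s\<^sub>0 within S"
  have lin: "linear (G t)" and add: "G (s + t) x = G s (G t x)" and G0: "G 0 x = x" for s t x
    using G by (auto simp: C0_group_def bounded_linear.linear)
  have bound: "norm (G t x - G t\<^sub>0 x\<^sub>0) \<le> norm (x - x\<^sub>0) + norm (G (t - t\<^sub>0) x\<^sub>0 - x\<^sub>0)" for t t\<^sub>0 x x\<^sub>0
  proof -
    have "norm (G t x - G t\<^sub>0 x\<^sub>0) \<le> norm (G t (x - x\<^sub>0)) + norm (G t\<^sub>0 (G (t - t\<^sub>0) x\<^sub>0 - x\<^sub>0))"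
      using norm_triangle_ineq[of "G t (x - x\<^sub>0)" "G t\<^sub>0 (G (t - t\<^sub>0) x\<^sub>0 - x\<^sub>0)"]
      by (simp add: linear_diff[OF lin] add[symmetric])
    then show ?thesis by (simp add: iso)
  qed
  have "((\<lambda>t. G t (y s\<^sub>0)) \<longlongrightarrow> y s\<^sub>0) (at 0)" using G by (simp add: C0_group_def)
  \<comment> \<open>The limit in \<open>C0_group\<close> is punctured. Using \<open>G 0 = id\<close>
    it becomes continuity at 0, which allows composition with \<open>f s - f s\<^sub>0\<close> even
    where that difference vanishes.\<close>
  then have "isCont (\<lambda>t. G t (y s\<^sub>0)) 0" by (simp add: isCont_def G0)
  moreover have "((\<lambda>s. f s - f s\<^sub>0) \<longlongrightarrow> 0) ?F"
    using f s0 by (simp add: continuous_on_def LIM_zero)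
  ultimately have "((\<lambda>s. G (f s - f s\<^sub>0) (y s\<^sub>0)) \<longlongrightarrow> G 0 (y s\<^sub>0)) ?F"
    by (rule isCont_tendsto_compose)
  moreover have "(y \<longlongrightarrow> y s\<^sub>0) ?F" using y s0 by (simp add: continuous_on_def)
  ultimately have "((\<lambda>s. norm (y s - y s\<^sub>0) + norm (G (f s - f s\<^sub>0) (y s\<^sub>0) - y s\<^sub>0)) \<longlongrightarrow> 0) ?F"
    by (auto intro!: tendsto_eq_intros simp: G0)
  then have "((\<lambda>s. G (f s) (y s) - G (f s\<^sub>0) (y s\<^sub>0)) \<longlongrightarrow> 0) ?F"
    by (rule Lim_null_comparison[rotated]) (intro always_eventually allI bound)
  then show "((\<lambda>s. G (f s) (y s)) \<longlongrightarrow> G (f s\<^sub>0) (y s\<^sub>0)) ?F" by (rule LIM_zero_cancel)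
qed

text \<open>With \<open>q = \<beta> * (sqrt T * r)\<close>, the bound is
  \<open>norm x\<^sub>0\<close> times the geometric tail \<open>q^2 + q^3 + ...\<close>, which
  estimates the Volterra terms of order two and higher. It is obtained from the integral equation
  itself, without expanding the series.\<close>

lemma mild_solution_first_order:
  fixes B :: "'h::{banach, second_countable_topology} \<Rightarrow> 'h"
  assumes G: "C0_group G" and iso: "\<And>t x. norm (G t x) = norm x" and exp: "exp_group D A = G"
    and B: "bounded_linear B" and norm_B: "\<And>x. norm (B x) \<le> \<beta> * norm x" and \<beta>: "0 \<le> \<beta>"
    and T: "0 \<le> T" and u: "norm u \<le> r" and q: "\<beta> * (sqrt T * r) < 1"
    and sol: "mild_solution D A B T (rep_L2 u) x\<^sub>0 x"
  shows "norm (x T - (G T x\<^sub>0 + (LINT s:{0..T}|lborel. rep_L2 u s *\<^sub>R G (T - s) (B (G s x\<^sub>0)))))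
    \<le> (\<beta> * (sqrt T * r))\<^sup>2 * norm x\<^sub>0 / (1 - \<beta> * (sqrt T * r))"
proof -
  define q where "q = \<beta> * (sqrt T * r)"
  have q1: "q < 1" using q by (simp add: q_def)
  have lin: "linear (G t)" for t using G by (auto simp: C0_group_def bounded_linear.linear)
  have cont: "continuous_on {0..T} x"
    and int: "\<And>t. t \<in> {0..T} \<Longrightarrow> set_integrable lborel {0..t} (\<lambda>s. rep_L2 u s *\<^sub>R G (t - s) (B (x s)))"
    and eq: "\<And>t. t \<in> {0..T} \<Longrightarrow>
      x t = G t x\<^sub>0 + (LINT s:{0..t}|lborel. rep_L2 u s *\<^sub>R G (t - s) (B (x s)))"
    using sol unfolding mild_solution_def exp by auto
  \<comment> \<open>Stated for a general \<open>y\<close> because it is used twice: for the solution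
    and for its deviation from the free motion \<open>G s x\<^sub>0\<close>.\<close>
  have q_bound: "norm (LINT s:{0..t}|lborel. rep_L2 u s *\<^sub>R G (t - s) (B (y s))) \<le> q * M"
    if t: "t \<in> {0..T}" and y: "\<And>s. s \<in> {0..t} \<Longrightarrow> norm (y s) \<le> M"
      and i: "set_integrable lborel {0..t} (\<lambda>s. rep_L2 u s *\<^sub>R G (t - s) (B (y s)))" for t y M
  proof -
    have M: "0 \<le> M" using y[of 0] t order_trans[OF norm_ge_zero] by auto
    have "norm (G (t - s) (B (y s))) \<le> \<beta> * M" if "s \<in> {0..t}" for s
      unfolding iso by (rule order_trans[OF norm_B mult_left_mono[OF y[OF that] \<beta>]])
    then have "norm (LINT s:{0..t}|lborel. rep_L2 u s *\<^sub>R G (t - s) (B (y s))) \<le> \<beta> * M * (sqrt T * norm u)"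
      using t by (intro L2_control_integral_bound i) auto
    also have "\<dots> \<le> \<beta> * M * (sqrt T * r)"
      using u \<beta> M T by (intro mult_left_mono) auto
    finally show ?thesis by (simp add: q_def mult_ac)
  qed
  \<comment> \<open>Compactness gives a finite maximum \<open>m\<close>, so that
    \<open>m \<le> norm x\<^sub>0 + q * m\<close> can be solved for \<open>m\<close> when
    \<open>q < 1\<close>.\<close>
  obtain t\<^sub>m where tm: "t\<^sub>m \<in> {0..T}" and max: "\<And>t. t \<in> {0..T} \<Longrightarrow> norm (x t) \<le> norm (x t\<^sub>m)"
    using continuous_attains_sup[OF compact_Icc _ continuous_on_norm[OF cont]] T by auto
  define m where "m = norm (x t\<^sub>m)"
  have dev: "norm (x t - G t x\<^sub>0) \<le> q * m" if t: "t \<in> {0..T}" for t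
    using q_bound[OF t _ int[OF t]] max t eq[OF t] by (simp add: m_def)
  have "m \<le> norm x\<^sub>0 + q * m"
    using dev[OF tm] norm_triangle_sub[of "x t\<^sub>m" "G t\<^sub>m x\<^sub>0"] by (simp add: m_def iso)
  then have m: "m \<le> norm x\<^sub>0 / (1 - q)" using q1 by (simp add: field_simps)
  have int0: "set_integrable lborel {0..T} (\<lambda>s. rep_L2 u s *\<^sub>R G (T - s) (B (G s x\<^sub>0)))"
    by (intro L2_control_set_integrable[OF T] continuous_on_isometric_C0_group[OF G iso]
        bounded_linear.continuous_on[OF B] continuous_intros)
  have T': "T \<in> {0..T}" using T by simp
  have diff: "rep_L2 u s *\<^sub>R G (T - s) (B (x s)) - rep_L2 u s *\<^sub>R G (T - s) (B (G s x\<^sub>0))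
      = rep_L2 u s *\<^sub>R G (T - s) (B (x s - G s x\<^sub>0))" for s
    by (simp add: linear_diff[OF lin] linear_diff[OF bounded_linear.linear[OF B]] scaleR_diff_right)
  \<comment> \<open>The free terms cancel, leaving the integral operator applied to the deviation
    \<open>x s - G s x\<^sub>0\<close>. That deviation is already at most \<open>q * m\<close>, so a
    second factor \<open>q\<close> appears.\<close>
  have "x T - (G T x\<^sub>0 + (LINT s:{0..T}|lborel. rep_L2 u s *\<^sub>R G (T - s) (B (G s x\<^sub>0))))
      = (LINT s:{0..T}|lborel. rep_L2 u s *\<^sub>R G (T - s) (B (x s - G s x\<^sub>0)))"
    using set_integral_diff(2)[OF int[OF T'] int0] eq[OF T'] by (simp add: diff)
  also have "norm \<dots> \<le> q * (q * m)"
    using set_integral_diff(1)[OF int[OF T'] int0] dev by (intro q_bound[OF T']) (auto simp: diff)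
  also have "\<dots> = q\<^sup>2 * m" by (simp add: power2_eq_square)
  also have "\<dots> \<le> q\<^sup>2 * (norm x\<^sub>0 / (1 - q))" using m by (rule mult_left_mono) simp
  finally show ?thesis by (simp add: q_def)
qed

section \<open>The beam actuated along its whole length\<close>

theorem corollary1:
  fixes L a r T :: real and K :: "L2 set" and x\<^sub>0 :: "ell2 \<times> ell2" and n :: nat
  assumes "L > 0" and "a > 0" and "r > 0" and "T > 0"
    and "K \<noteq> {}" and "K \<subseteq> L2_interval T" and "\<And>u. u \<in> K \<Longrightarrow> norm u \<le> r"
    and "T < (a / r)\<^sup>2"
    and "n \<ge> 1"
  shows "kolmogorov_width UNIV n
           (reachable_set (beam_domain a L) (beam_A a L) (beam_B a L 0 L) K T x\<^sub>0)
         \<le> ereal (norm x\<^sub>0 * sqrt T / a) * kolmogorov_width (L2_interval T) n K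
           + ereal (norm x\<^sub>0 * T * r\<^sup>2 / (a * (a - sqrt T * r)))"
proof -
  let ?G = "beam_group a L" and ?B = "beam_B a L 0 L"
  \<comment> \<open>The kernel of the first-order Volterra term at time \<open>T\<close>. It does
    not depend on the control, so the term is linear in \<open>u\<close>.\<close>
  define g where "g = (\<lambda>s. ?G (T - s) (?B (?G s x\<^sub>0)))"
  define \<Lambda> where "\<Lambda> = (\<lambda>u. LINT s:{0..T}|lborel. rep_L2 u s *\<^sub>R g s)"
  have B_eq: "?B x = (0, - (1 / a) *\<^sub>R fst x)" for x
    using beam_B_full[OF assms(2,1), of "fst x" "snd x"] by simp
  have B: "bounded_linear ?B"
    unfolding B_eq by (intro bounded_linear_Pair bounded_linear_zero bounded_linear_const_scaleR bounded_linear_fst)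
  have norm_B: "norm (?B x) \<le> (1 / a) * norm x" for x
    using assms(2) norm_fst_le[of "fst x" "snd x"] by (simp add: B_eq norm_prod_def divide_right_mono)
  have g_cont: "continuous_on {0..T} g"
    unfolding g_def
    by (intro continuous_on_isometric_C0_group[OF beam_group_C0 beam_group_norm]
        bounded_linear.continuous_on[OF B] continuous_intros)
  have g_bound: "norm (g s) \<le> norm x\<^sub>0 / a" for s
    using norm_B[of "?G s x\<^sub>0"] by (simp add: g_def beam_group_norm)
  \<comment> \<open>The smallness condition on \<open>T\<close>, after taking square roots, says
    that the contraction factor \<open>sqrt T * r / a\<close> is below 1.\<close>
  have sqrtT: "sqrt T * r < a"
    using real_sqrt_less_mono[OF assms(8)] assms(2,3) by (simp add: pos_less_divide_eq del: power_divide)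
  show ?thesis
  proof (rule kolmogorov_width_linear_approx[where \<Lambda> = \<Lambda> and c\<^sub>0 = "?G T x\<^sub>0"])
    show "linear \<Lambda>"
      unfolding \<Lambda>_def using assms(4) g_cont by (intro linear_L2_control_integral) auto
    show "norm (\<Lambda> v) \<le> norm x\<^sub>0 * sqrt T / a * norm v" for v
      using L2_control_integral_bound[OF _ _ g_bound L2_control_set_integrable[OF _ g_cont], of T v] assms(4)
      by (simp add: \<Lambda>_def)
    show "0 \<le> norm x\<^sub>0 * sqrt T / a" using assms(2,4) by simp
    show "0 \<in> L2_interval T" by (rule subspace_0[OF subspace_L2_interval])
    fix x assume "x \<in> reachable_set (beam_domain a L) (beam_A a L) ?B K T x\<^sub>0"
    \<comment> \<open>The control that steers to \<open>x\<close> is also the witness for the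
      approximation of \<open>x\<close>.\<close>
    then obtain y u where u: "u \<in> K" and x: "x = y T"
      and sol: "mild_solution (beam_domain a L) (beam_A a L) ?B T (rep_L2 u) x\<^sub>0 y"
      unfolding reachable_set_def by blast
    have "norm (x - (?G T x\<^sub>0 + \<Lambda> u)) \<le> (1 / a * (sqrt T * r))\<^sup>2 * norm x\<^sub>0 / (1 - 1 / a * (sqrt T * r))"
      unfolding x \<Lambda>_def g_def using assms(2,4,7) u sqrtT
      by (intro mild_solution_first_order[OF beam_group_C0 beam_group_norm exp_group_beam B norm_B _ _ _ _ sol]) auto
    \<comment> \<open>Here \<open>(sqrt T)\<^sup>2 = T\<close>, and one of the two factors
      \<open>a\<close> in the denominator cancels against
      \<open>1 - sqrt T * r / a = (a - sqrt T * r) / a\<close>.\<close>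
    also have "\<dots> = norm x\<^sub>0 * T * r\<^sup>2 / (a * (a - sqrt T * r))"
      using assms(2,4) sqrtT by (simp add: power_mult_distrib power_divide field_simps power2_eq_square)
    finally show "\<exists>u\<in>K. norm (x - (?G T x\<^sub>0 + \<Lambda> u)) \<le> norm x\<^sub>0 * T * r\<^sup>2 / (a * (a - sqrt T * r))"
      using u by blast
  qed
qed

end
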